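(* For $n\ge1$ let $c^n_{x,y}$ be the conductances of the set consisting of the bottom row $x_0,\dots,x_{2^n}$ of $V_n$ together with the top point $q_0$, write $c^n_{i,j}=c^n_{x_i,x_j}$, and set $l_n=c^n_{0,1}$ and $m_n=c^n_{2^{n-1}-1,\,2^{n-1}}=c^n_{2^{n-1},\,2^{n-1}+1}$. Then $m_1=l_1=\frac{20}{9}$ and, for $n\ge1$, $$m_{n+1}=\frac53\,l_n+\frac{294\cdot25^{n+1}}{(3^{n+1}+6\cdot10^{n+1})(5\cdot3^{n+1}+9\cdot10^{n+1})}.$$
   Context: Let $q_0,q_1,q_2$ be the vertices of an equilateral triangle in the plane, $F_i(x)=\frac12(x+q_i)$, and let $SG$ (the Sierpinski gasket) be the unique nonempty compact set with $SG=\bigcup_{i}F_i(SG)$. For a word $w$ of length $m$ let $F_w=F_{w_1}\circ\cdots\circ F_{w_m}$. Put $V_0=\{q_0,q_1,q_2\}$, $V_m=\bigcup_iF_iV_{m-1}$; $x\sim_m y$ means $x\ne y$ and $x,y\in F_wV_0$ for some word $w$ of length $m$. The bottom row of $V_n$ consists of the points $x_i=q_1+\frac{i}{2^n}(q_2-q_1)$, $0\le i\le2^n$. The energy of a continuous $u:SG\to\mathbb{R}$ is $\mathcal{E}(u)=\lim_{m\to\infty}\left(\frac53\right)^m\sum_{\{x,y\}:x\sim_m y}(u(x)-u(y))^2$ (a nondecreasing limit), and $\operatorname{dom}\mathcal{E}$ is the set of continuous $u$ with $\mathcal{E}(u)<\infty$. For a nonempty set $A\subset V_n$ and values prescribed on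 $A$, there is a unique $u\in\operatorname{dom}\mathcal{E}$ of least energy with these values on $A$, and its energy has the form $\mathcal{E}(u)=\sum_{\{x,y\}\subset A}c_{x,y}(u(x)-u(y))^2$; the (uniquely determined, symmetric) coefficients $c_{x,y}$, $x\neq y$, are the conductances of $A$. *)

theory Defs
  imports "HOL-Analysis.Analysis"
begin

text \<open>
  The triangle is given by \<open>q :: nat \<Rightarrow> real^2\<close>, of which only the values at
  \<open>0, 1, 2\<close> are used; words are lists over \<open>{0, 1, 2}\<close>.
\<close>

definition equilateral :: "(nat \<Rightarrow> real^2) \<Rightarrow> bool" where
  "equilateral q \<longleftrightarrow> q 0 \<noteq> q 1 \<and>
     dist (q 0) (q 1) = dist (q 1) (q 2) \<and> dist (q 0) (q 1) = dist (q 0) (q 2)"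

definition F :: "(nat \<Rightarrow> real^2) \<Rightarrow> nat \<Rightarrow> real^2 \<Rightarrow> real^2" where
  "F q i x = (1/2) *\<^sub>R (x + q i)"

definition SG :: "(nat \<Rightarrow> real^2) \<Rightarrow> (real^2) set" where
  "SG q = (THE K. compact K \<and> K \<noteq> {} \<and> K = (\<Union>i\<in>{0,1,2}. F q i ` K))"

primrec F_word :: "(nat \<Rightarrow> real^2) \<Rightarrow> nat list \<Rightarrow> real^2 \<Rightarrow> real^2" where
  "F_word q [] = id"
| "F_word q (i # w) = F q i \<circ> F_word q w"

primrec V :: "(nat \<Rightarrow> real^2) \<Rightarrow> nat \<Rightarrow> (real^2) set" where
  "V q 0 = q ` {0,1,2}"
| "V q (Suc m) = (\<Union>i\<in>{0,1,2}. F q i ` V q m)"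

definition adj :: "(nat \<Rightarrow> real^2) \<Rightarrow> nat \<Rightarrow> real^2 \<Rightarrow> real^2 \<Rightarrow> bool" where
  "adj q m x y \<longleftrightarrow> x \<noteq> y \<and>
     (\<exists>w. length w = m \<and> set w \<subseteq> {0,1,2} \<and> x \<in> F_word q w ` V q 0 \<and> y \<in> F_word q w ` V q 0)"

text \<open>
  Sums over unordered pairs \<open>{x, y}\<close> are written as half of the sum over ordered pairs.
  A function on \<open>SG q\<close> is a function on the plane of which only the values on \<open>SG q\<close> matter.
\<close>

definition graph_energy :: "(nat \<Rightarrow> real^2) \<Rightarrow> nat \<Rightarrow> (real^2 \<Rightarrow> real) \<Rightarrow> real" where
  "graph_energy q m u = (\<Sum>(x, y)\<in>{(x, y). adj q m x y}. (u x - u y)\<^sup>2) / 2"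

definition energy :: "(nat \<Rightarrow> real^2) \<Rightarrow> (real^2 \<Rightarrow> real) \<Rightarrow> ereal" where
  "energy q u = lim (\<lambda>m. ereal ((5/3) ^ m * graph_energy q m u))"

definition dom_energy :: "(nat \<Rightarrow> real^2) \<Rightarrow> (real^2 \<Rightarrow> real) set" where
  "dom_energy q = {u. continuous_on (SG q) u \<and> energy q u < \<infinity>}"

definition least_energy_extension ::
    "(nat \<Rightarrow> real^2) \<Rightarrow> (real^2) set \<Rightarrow> (real^2 \<Rightarrow> real) \<Rightarrow> (real^2 \<Rightarrow> real) \<Rightarrow> bool" where
  "least_energy_extension q A f u \<longleftrightarrow>
     u \<in> dom_energy q \<and> (\<forall>x\<in>A. u x = f x) \<and>
     (\<forall>v\<in>dom_energy q. (\<forall>x\<in>A. v x = f x) \<longrightarrow> energy q u \<le> energy q v)"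

text \<open>
  The coefficients are only meaningful for distinct points of \<open>A\<close>; all others are set to \<open>0\<close>
  to make the coefficient function unique.
\<close>

definition is_conductance ::
    "(nat \<Rightarrow> real^2) \<Rightarrow> (real^2) set \<Rightarrow> (real^2 \<Rightarrow> real^2 \<Rightarrow> real) \<Rightarrow> bool" where
  "is_conductance q A c \<longleftrightarrow>
     (\<forall>x y. c x y = c y x) \<and>
     (\<forall>x y. x \<notin> A \<or> y \<notin> A \<or> x = y \<longrightarrow> c x y = 0) \<and>
     (\<forall>f. \<exists>u. least_energy_extension q A f u \<and>
        energy q u = ereal ((\<Sum>x\<in>A. \<Sum>y\<in>A. c x y * (u x - u y)\<^sup>2) / 2))"

definition conductance ::
    "(nat \<Rightarrow> real^2) \<Rightarrow> (real^2) set \<Rightarrow> real^2 \<Rightarrow> real^2 \<Rightarrow> real" where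
  "conductance q A = (THE c. is_conductance q A c)"

definition bottom_point :: "(nat \<Rightarrow> real^2) \<Rightarrow> nat \<Rightarrow> nat \<Rightarrow> real^2" where
  "bottom_point q n i = q 1 + (real i / 2 ^ n) *\<^sub>R (q 2 - q 1)"

definition bottom_and_top :: "(nat \<Rightarrow> real^2) \<Rightarrow> nat \<Rightarrow> (real^2) set" where
  "bottom_and_top q n = insert (q 0) (bottom_point q n ` {0..2 ^ n})"

definition row_conductance :: "(nat \<Rightarrow> real^2) \<Rightarrow> nat \<Rightarrow> nat \<Rightarrow> nat \<Rightarrow> real" where
  "row_conductance q n i j =
     conductance q (bottom_and_top q n) (bottom_point q n i) (bottom_point q n j)"

definition end_conductance :: "(nat \<Rightarrow> real^2) \<Rightarrow> nat \<Rightarrow> real" where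
  "end_conductance q n = row_conductance q n 0 1"

definition middle_conductance :: "(nat \<Rightarrow> real^2) \<Rightarrow> nat \<Rightarrow> real" where
  "middle_conductance q n = row_conductance q n (2 ^ (n - 1) - 1) (2 ^ (n - 1))"

end

theory Submission
  imports Defs
begin

text \<open>
  The bottom row together with the top point of level \<open>n + 1\<close> is obtained by glueing two copies of
  level \<open>n\<close>, scaled by \<open>5/3\<close>, to a small triangle at the top and eliminating the two inner vertices
  \<open>F\<^sub>0 q\<^sub>1\<close> and \<open>F\<^sub>0 q\<^sub>2\<close>. If \<open>t\<^sub>i\<close> are the conductances to the top point at level \<open>n\<close> and \<open>T\<close> is their
  sum, the elimination gives \<open>m\<^bsub>n+1\<^esub> = 5/3 (l\<^sub>n + t\<^sub>0 t\<^sub>1 / (1 + T))\<close> and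
  \<open>T' = 10/3 T / (1 + T)\<close>, so that \<open>1 / T\<close> satisfies an affine recursion with an explicit solution.

  The conductances are actually attained because each level reduces to the harmonic extension of
  three boundary values, which is the uniform limit of repeated applications of the
  \<open>(2/5, 2/5, 1/5)\<close> rule, and harmonic pieces may be glued along the gasket.
\<close>

subsection \<open>The gasket\<close>

text \<open>\<open>SG\<close> and \<open>conductance\<close> are definite descriptions and
  \<open>energy\<close> is a limit, so the electrical computation only counts once the compact set
  and the coefficients are known to be unique and a continuous minimiser is known to exist. The two
  halves of the minimisation are kept apart. The lower bound uses finite levels only:
  \<open>renormalized_energy\<close> splits exactly over the three cells and increases with the
  level, so the bound holds for every function, continuous or not. Continuity enters only in the
  construction of a function that attains it, whose energies are constant from level
  \<open>n\<close> on. Both halves are inductions driven by one identity, in which eliminating the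
  two inner vertices leaves a nonnegative remainder: dropping it gives the bound, and choosing the
  inner values that make it vanish gives equality.\<close>

lemma F_inverse [simp]: "2 *\<^sub>R F q i x - q i = x"
  by (simp add: F_def scaleR_2)

lemma F_eq_iff [simp]: "F q i x = F q i y \<longleftrightarrow> x = y"
  by (metis F_inverse)

lemma F_fixed [simp]: "F q i (q i) = q i"
  by (simp add: F_def flip: scaleR_2)

lemma F_commute: "F q i (q j) = F q j (q i)"
  by (simp add: F_def add.commute)

lemma continuous_on_F [continuous_intros]: "continuous_on S (F q i)"
  unfolding F_def by (intro continuous_intros)

lemma dist_F: "dist (F q i x) (F q i y) = dist x y / 2"
proof -
  have "F q i x - F q i y = (1/2) *\<^sub>R (x - y)"
    by (simp add: F_def algebra_simps)
  then show ?thesis by (simp add: dist_norm)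
qed

lemma compact_F_image: "compact S \<Longrightarrow> compact (F q i ` S)"
  by (intro compact_continuous_image continuous_intros)

section \<open>Existence and uniqueness of the self-similar compact set\<close>

definition self_similar :: "(nat \<Rightarrow> real^2) \<Rightarrow> (real^2) set \<Rightarrow> bool" where
  "self_similar q K \<longleftrightarrow> compact K \<and> K \<noteq> {} \<and> K = (\<Union>i\<in>{0,1,2}. F q i ` K)"

text \<open>The point of \<open>L\<close> nearest to \<open>x\<close> is sent by
  \<open>F q i\<close> into \<open>L\<close> again, and \<open>F q i\<close> halves
  distances.\<close>

lemma infdist_F_le:
  assumes "self_similar q L" "i \<in> {0,1,2}"
  shows "infdist (F q i x) L \<le> infdist x L / 2"
proof -
  have "compact L" "L \<noteq> {}" using assms(1) by (auto simp: self_similar_def)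
  then obtain y where y: "y \<in> L" "infdist x L = dist x y"
    using infdist_attains_inf[of L x] by (metis compact_imp_closed)
  have "F q i y \<in> L" using assms y(1) unfolding self_similar_def by blast
  then have "infdist (F q i x) L \<le> dist (F q i x) (F q i y)" by (rule infdist_le)
  then show ?thesis by (simp add: dist_F y)
qed

text \<open>The largest distance from a point of \<open>K\<close> to \<open>L\<close> is attained at
  some \<open>F q i y\<close> with \<open>y\<close> in \<open>K\<close>, so it is at most half of
  itself and therefore zero. Applied in both directions this gives uniqueness.\<close>

lemma self_similar_subset:
  assumes K: "self_similar q K" and L: "self_similar q L"
  shows "K \<subseteq> L"
proof -
  have cK: "compact K" "K \<noteq> {}" and cL: "closed L" "L \<noteq> {}"
    using assms by (auto simp: self_similar_def compact_imp_closed)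
  obtain x where x: "x \<in> K" "\<And>y. y \<in> K \<Longrightarrow> infdist y L \<le> infdist x L"
    using continuous_attains_sup[OF cK, of "\<lambda>x. infdist x L"] continuous_on_infdist[OF continuous_on_id]
    by blast
  obtain i y where y: "i \<in> {0,1,2}" "y \<in> K" "x = F q i y"
    using K x(1) unfolding self_similar_def by blast
  have "infdist x L \<le> infdist x L / 2"
    using infdist_F_le[OF L y(1), of y] x(2)[OF y(2)] y(3) by simp
  then have "infdist y L = 0" if "y \<in> K" for y
    using x(2)[OF that] infdist_nonneg[of y L] by linarith
  then show ?thesis using in_closed_iff_infdist_zero[OF cL] by blast
qed

lemma self_similar_vertex:
  assumes "self_similar q K" "i \<in> {0,1,2}"
  shows "q i \<in> K"
proof -
  have "infdist (q i) K \<le> infdist (q i) K / 2"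
    using infdist_F_le[OF assms, of "q i"] by simp
  then have "infdist (q i) K = 0" using infdist_nonneg[of "q i" K] by linarith
  then show ?thesis
    using in_closed_iff_infdist_zero assms(1) compact_imp_closed unfolding self_similar_def by blast
qed

primrec prefractal :: "(nat \<Rightarrow> real^2) \<Rightarrow> (real^2) set \<Rightarrow> nat \<Rightarrow> (real^2) set" where
  "prefractal q B 0 = B"
| "prefractal q B (Suc m) = (\<Union>i\<in>{0,1,2}. F q i ` prefractal q B m)"

text \<open>The iterated images of \<open>B\<close> form a decreasing sequence of nonempty compact
  sets, so they meet. The hard inclusion of the fixed-point equation exchanges the intersection over
  levels with the union over the three maps.\<close>

lemma self_similar_prefractal:
  assumes B: "compact B" "B \<noteq> {}" and sub: "\<And>i. i \<in> {0,1,2} \<Longrightarrow> F q i ` B \<subseteq> B"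
  shows "self_similar q (\<Inter>m. prefractal q B m)"
proof -
  let ?S = "prefractal q B" let ?K = "\<Inter>m. ?S m"
  have comp: "compact (?S m) \<and> ?S m \<noteq> {}" for m
    by (induction m) (use B in \<open>auto intro!: compact_Un compact_F_image\<close>)
  have dec1: "?S (Suc m) \<subseteq> ?S m" for m
  proof (induction m)
    case 0 then show ?case using sub by auto
  next
    case (Suc m)
    then show ?case by (subst prefractal.simps(2), subst (2) prefractal.simps(2)) blast
  qed
  have dec: "?S n \<subseteq> ?S m" if "m \<le> n" for m n
    using that by (rule lift_Suc_antimono_le[of ?S, OF dec1])
  have "compact ?K" using comp by (intro compact_Inter) auto
  moreover have "?K \<noteq> {}"
    by (rule compact_nest) (use comp dec in auto)
  moreover have "?K = (\<Union>i\<in>{0,1,2}. F q i ` ?K)"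
  proof
    show "(\<Union>i\<in>{0,1,2}. F q i ` ?K) \<subseteq> ?K"
    proof (intro subsetI INT_I)
      fix x m assume "x \<in> (\<Union>i\<in>{0,1,2}. F q i ` ?K)"
      then have "x \<in> ?S (Suc m)" by auto
      then show "x \<in> ?S m" using dec1 by blast
    qed
    show "?K \<subseteq> (\<Union>i\<in>{0,1,2}. F q i ` ?K)"
    proof (intro subsetI, rule ccontr)
      fix x assume x: "x \<in> ?K" and "x \<notin> (\<Union>i\<in>{0,1,2}. F q i ` ?K)"
      then have x': "x \<notin> F q i ` ?K" if "i \<in> {0,1,2}" for i using that by (metis UN_I)
      have "\<exists>m. x \<notin> F q i ` ?S m" if i: "i \<in> {0,1,2}" for i
      proof (rule ccontr)
        assume a: "\<not> ?thesis"
        then have "2 *\<^sub>R x - q i \<in> ?S m" for m by auto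
        then have "2 *\<^sub>R x - q i \<in> ?K" by blast
        moreover have "F q i (2 *\<^sub>R x - q i) = x" by (simp add: F_def)
        ultimately show False using x'[OF i] by (metis imageI)
      qed
      \<comment> \<open>Each of the three maps loses \<open>x\<close> at its own level; the sets
        decrease, so at the largest of these levels all three have lost it.\<close>
      then obtain m where m: "\<And>i. i \<in> {0,1,2} \<Longrightarrow> x \<notin> F q i ` ?S (m i)" by metis
      let ?M = "max (m 0) (max (m 1) (m 2))"
      have "x \<in> ?S (Suc ?M)" using x by blast
      then obtain i where i: "i \<in> {0,1,2}" "x \<in> F q i ` ?S ?M" by auto
      then have "m i \<le> ?M" by auto
      from dec[OF this] m i show False by blast
    qed
  qed
  ultimately show ?thesis unfolding self_similar_def by (intro conjI)
qed

locale gasket =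
  fixes q :: "nat \<Rightarrow> real^2"
  assumes equilateral: "equilateral q"
begin

text \<open>Barycentric coordinates; the formula uses that the triangle is equilateral.\<close>

definition bary :: "nat \<Rightarrow> real^2 \<Rightarrow> real" where
  "bary i x = 1 + 2 / (3 * (dist (q 0) (q 1))\<^sup>2) * ((x - q i) \<bullet> (3 *\<^sub>R q i - (q 0 + q 1 + q 2)))"

text \<open>Gram matrix of two sides of the triangle; the mixed entry comes from the length of the
  third side.\<close>

lemma inner_sides:
  defines "s \<equiv> (dist (q 0) (q 1))\<^sup>2"
  shows "s > 0" "(q 1 - q 0) \<bullet> (q 1 - q 0) = s" "(q 2 - q 0) \<bullet> (q 2 - q 0) = s"
    "(q 1 - q 0) \<bullet> (q 2 - q 0) = s / 2"
proof -
  have eq: "q 0 \<noteq> q 1" "dist (q 1) (q 2) = dist (q 0) (q 1)" "dist (q 0) (q 2) = dist (q 0) (q 1)"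
    using equilateral by (auto simp: equilateral_def)
  show "s > 0" using eq by (simp add: s_def)
  show 1: "(q 1 - q 0) \<bullet> (q 1 - q 0) = s"
    by (simp add: s_def dist_norm norm_minus_commute flip: power2_norm_eq_inner)
  show 2: "(q 2 - q 0) \<bullet> (q 2 - q 0) = s"
    unfolding s_def eq(3)[symmetric]
    by (simp add: dist_norm norm_minus_commute flip: power2_norm_eq_inner)
  have 3: "(q 1 - q 2) \<bullet> (q 1 - q 2) = s"
    unfolding s_def eq(2)[symmetric] by (simp add: dist_norm flip: power2_norm_eq_inner)
  show "(q 1 - q 0) \<bullet> (q 2 - q 0) = s / 2"
    using 1 2 3 by (simp add: inner_simps inner_commute)
qed

text \<open>For \<open>i \<noteq> j\<close> the inner product of \<open>q j - q i\<close> with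
  \<open>3 *\<^sub>R q i - (q 0 + q 1 + q 2)\<close> is -3/2 times the squared side, which the
  factor in \<open>bary\<close> turns into -1.\<close>

lemma bary_vertex:
  assumes "i \<in> {0,1,2}" "j \<in> {0,1,2}"
  shows "bary i (q j) = (if i = j then 1 else 0)"
proof -
  define p r s where "p = q 1 - q 0" and "r = q 2 - q 0" and "s = (dist (q 0) (q 1))\<^sup>2"
  have *: "s > 0" "p \<bullet> p = s" "r \<bullet> r = s" "p \<bullet> r = s / 2" "r \<bullet> p = s / 2"
    using inner_sides by (auto simp: p_def r_def s_def inner_commute)
  have q: "q 1 = q 0 + p" "q 2 = q 0 + r" by (auto simp: p_def r_def)
  have S: "3 *\<^sub>R q 0 - (q 0 + q 1 + q 2) = - p - r" "3 *\<^sub>R q 1 - (q 0 + q 1 + q 2) = 2 *\<^sub>R p - r"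
    "3 *\<^sub>R q 2 - (q 0 + q 1 + q 2) = 2 *\<^sub>R r - p"
    unfolding q by (simp_all add: vec_eq_iff)
  consider "i = 0" | "i = 1" | "i = 2" using assms by auto
  then show ?thesis
  proof cases
    case 1
    show ?thesis unfolding bary_def 1 S s_def[symmetric] using assms(2) *
      by (auto simp: q[unfolded One_nat_def] inner_simps field_simps)
  next
    case 2
    show ?thesis unfolding bary_def 2 S s_def[symmetric] using assms(2) *
      by (auto simp: q[unfolded One_nat_def] inner_simps field_simps)
  next
    case 3
    show ?thesis unfolding bary_def 3 S s_def[symmetric] using assms(2) *
      by (auto simp: q[unfolded One_nat_def] inner_simps field_simps)
  qed
qed

lemma bary_F: "bary i (F q j x) = (bary i x + bary i (q j)) / 2"
proof -
  have *: "F q j x - q i = (1/2) *\<^sub>R ((x - q i) + (q j - q i))"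
    by (simp add: F_def vec_eq_iff field_simps)
  have "1 + k * ((1/2) * (a + b)) = ((1 + k * a) + (1 + k * b)) / 2" for k a b :: real
    by (simp add: field_simps)
  then show ?thesis unfolding bary_def * inner_scaleR_left inner_add_left by blast
qed

lemma sum_bary: "bary 0 x + bary 1 x + bary 2 x = 1"
proof -
  define p r s y where "p = q 1 - q 0" and "r = q 2 - q 0" and "s = (dist (q 0) (q 1))\<^sup>2"
    and "y = x - q 0"
  have *: "s > 0" "p \<bullet> p = s" "r \<bullet> r = s" "p \<bullet> r = s / 2" "r \<bullet> p = s / 2"
    using inner_sides by (auto simp: p_def r_def s_def inner_commute)
  have q: "q 1 = q 0 + p" "q 2 = q 0 + r" by (auto simp: p_def r_def)
  have S: "3 *\<^sub>R q 0 - (q 0 + q 1 + q 2) = - p - r" "3 *\<^sub>R q 1 - (q 0 + q 1 + q 2) = 2 *\<^sub>R p - r"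
    "3 *\<^sub>R q 2 - (q 0 + q 1 + q 2) = 2 *\<^sub>R r - p" "x - q 0 = y" "x - q 1 = y - p" "x - q 2 = y - r"
    unfolding q y_def by (simp_all add: vec_eq_iff)
  show ?thesis unfolding bary_def S s_def[symmetric] using * by (simp add: inner_simps field_simps)
qed

lemma continuous_on_bary [continuous_intros]: "continuous_on S (bary i)"
  unfolding bary_def by (intro continuous_intros)

text \<open>The defect in recovering \<open>x\<close> from its own coordinates. It is halved by each
  \<open>F q i\<close>, so contraction arguments dispose of it without any discussion of affine
  independence.\<close>

definition bary_err :: "real^2 \<Rightarrow> real^2" where
  "bary_err x = x - (bary 0 x *\<^sub>R q 0 + bary 1 x *\<^sub>R q 1 + bary 2 x *\<^sub>R q 2)"

lemma bary_err_F: "i \<in> {0,1,2} \<Longrightarrow> bary_err (F q i x) = (1/2) *\<^sub>R bary_err x"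
proof -
  assume i: "i \<in> {0,1,2}"
  define c0 c1 c2 where c: "c0 = bary 0 x" "c1 = bary 1 x" "c2 = bary 2 x"
  have v: "bary 0 (q i) *\<^sub>R q 0 + bary 1 (q i) *\<^sub>R q 1 + bary 2 (q i) *\<^sub>R q 2 = q i"
    using i bary_vertex[of _ i] by auto
  have "bary_err (F q i x) = (1/2) *\<^sub>R (x + q i) - (1/2) *\<^sub>R
    ((c0 *\<^sub>R q 0 + c1 *\<^sub>R q 1 + c2 *\<^sub>R q 2) + (bary 0 (q i) *\<^sub>R q 0 + bary 1 (q i) *\<^sub>R q 1 + bary 2 (q i) *\<^sub>R q 2))"
    unfolding bary_err_def bary_F c by (simp add: F_def vec_eq_iff field_simps)
  then show ?thesis unfolding v bary_err_def c by (simp add: vec_eq_iff field_simps)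
qed

definition triangle :: "(real^2) set" where
  "triangle = {x. (\<forall>i\<in>{0,1,2}. 0 \<le> bary i x) \<and> bary_err x = 0}"

lemma vertex_triangle: "i \<in> {0,1,2} \<Longrightarrow> q i \<in> triangle"
  unfolding triangle_def bary_err_def using bary_vertex[of _ i] by auto

lemma F_triangle: "i \<in> {0,1,2} \<Longrightarrow> x \<in> triangle \<Longrightarrow> F q i x \<in> triangle"
  unfolding triangle_def using bary_vertex[of _ i] by (auto simp: bary_F bary_err_F)

lemma triangle_eq_vertex:
  assumes "x \<in> triangle" "i \<in> {0,1,2}" "bary i x \<ge> 1"
  shows "x = q i"
proof -
  have b: "0 \<le> bary 0 x" "0 \<le> bary 1 x" "0 \<le> bary 2 x"
    and x: "x = bary 0 x *\<^sub>R q 0 + bary 1 x *\<^sub>R q 1 + bary 2 x *\<^sub>R q 2"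
    using assms(1) by (auto simp: triangle_def bary_err_def)
  consider "i = 0" | "i = 1" | "i = 2" using assms(2) by auto
  then have "bary 0 x = (if i = 0 then 1 else 0)" "bary 1 x = (if i = 1 then 1 else 0)"
    "bary 2 x = (if i = 2 then 1 else 0)"
    using b assms(3) sum_bary[of x] by (cases; simp; linarith)+
  with x assms(2) show ?thesis by auto
qed

lemma compact_triangle: "compact triangle"
proof -
  have "closed triangle"
    unfolding triangle_def bary_err_def
    by (simp only: Ball_def[symmetric] Collect_conj_eq Collect_ball_eq)
      (intro closed_Int closed_INT ballI closed_Collect_le closed_Collect_eq continuous_intros)
  moreover have "norm x \<le> norm (q 0) + norm (q 1) + norm (q 2)" if "x \<in> triangle" for x
  proof -
    have b: "0 \<le> bary 0 x" "0 \<le> bary 1 x" "0 \<le> bary 2 x"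
      and x: "x = bary 0 x *\<^sub>R q 0 + bary 1 x *\<^sub>R q 1 + bary 2 x *\<^sub>R q 2"
      using that by (auto simp: triangle_def bary_err_def)
    have "norm x \<le> norm (bary 0 x *\<^sub>R q 0) + norm (bary 1 x *\<^sub>R q 1) + norm (bary 2 x *\<^sub>R q 2)"
      by (subst x) (intro norm_triangle_le add_mono norm_triangle_ineq order_refl)
    also have "\<dots> \<le> 1 * norm (q 0) + 1 * norm (q 1) + 1 * norm (q 2)"
      unfolding norm_scaleR using b sum_bary[of x] by (intro add_mono mult_right_mono) auto
    finally show ?thesis by simp
  qed
  then have "bounded triangle" by (auto simp: bounded_iff)
  ultimately show ?thesis by (simp add: compact_eq_bounded_closed)
qed

lemma self_similar_SG: "self_similar q (SG q)"
proof -
  have *: "self_similar q (\<Inter>m. prefractal q triangle m)"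
    using vertex_triangle[of 0] F_triangle compact_triangle
    by (intro self_similar_prefractal) auto
  have "self_similar q (THE K. self_similar q K)"
    by (rule theI[where P = "self_similar q", OF *]) (metis * self_similar_subset subset_antisym)
  then show ?thesis unfolding SG_def self_similar_def .
qed

lemma compact_SG: "compact (SG q)"
  using self_similar_SG unfolding self_similar_def by (elim conjE)

lemma SG_eq: "SG q = (\<Union>i\<in>{0,1,2}. F q i ` SG q)"
  using self_similar_SG unfolding self_similar_def by (elim conjE)

lemma SG_cases:
  assumes "x \<in> SG q"
  obtains i y where "i \<in> {0,1,2}" "y \<in> SG q" "x = F q i y"
proof -
  have "x \<in> (\<Union>i\<in>{0,1,2}. F q i ` SG q)" using assms SG_eq by (rule subst[rotated])
  then show thesis using that by blast
qed

lemma F_SG: "i \<in> {0,1,2} \<Longrightarrow> x \<in> SG q \<Longrightarrow> F q i x \<in> SG q"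
  by (rule subst[OF SG_eq[symmetric], where P = "\<lambda>S. _ \<in> S"]) blast

lemma vertex_SG: "i \<in> {0,1,2} \<Longrightarrow> q i \<in> SG q"
  using self_similar_vertex[OF self_similar_SG] .

text \<open>Extremal argument: if a coordinate is minimal on \<open>SG q\<close> at
  \<open>F q j y\<close>, twice the minimum is the coordinate of \<open>y\<close> plus a vertex
  value 0 or 1, hence at least the minimum, which is thus nonnegative. The norm of
  \<open>bary_err\<close> is maximal at a point where it is half of another value, so it
  vanishes.\<close>

lemma SG_subset_triangle: "SG q \<subseteq> triangle"
proof -
  have ne: "SG q \<noteq> {}" using self_similar_SG unfolding self_similar_def by (elim conjE)
  have "0 \<le> bary i x" if i: "i \<in> {0,1,2}" and x: "x \<in> SG q" for i x
  proof -
    obtain z where z: "z \<in> SG q" "\<And>y. y \<in> SG q \<Longrightarrow> bary i z \<le> bary i y"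
      using continuous_attains_inf[OF compact_SG ne continuous_on_bary, of i] by auto
    obtain j y where y: "j \<in> {0,1,2}" "y \<in> SG q" "z = F q j y" using z(1) by (rule SG_cases)
    have "2 * bary i z = bary i y + bary i (q j)" unfolding y(3) bary_F by simp
    moreover have "bary i (q j) \<ge> 0" using bary_vertex[OF i y(1)] by simp
    ultimately have "0 \<le> bary i z" using z(2)[OF y(2)] by linarith
    with z(2)[OF x] show ?thesis by linarith
  qed
  moreover have "bary_err x = 0" if x: "x \<in> SG q" for x
  proof -
    have "continuous_on (SG q) (\<lambda>x. norm (bary_err x))"
      unfolding bary_err_def by (intro continuous_intros)
    then obtain z where z: "z \<in> SG q" "\<And>y. y \<in> SG q \<Longrightarrow> norm (bary_err y) \<le> norm (bary_err z)"
      using continuous_attains_sup[OF compact_SG ne] by blast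
    obtain j y where y: "j \<in> {0,1,2}" "y \<in> SG q" "z = F q j y" using z(1) by (rule SG_cases)
    have "norm (bary_err z) = norm (bary_err y) / 2" using y bary_err_F by simp
    then have "norm (bary_err z) \<le> 0" using z(2)[OF y(2)] by linarith
    with z(2)[OF x] have "norm (bary_err x) \<le> 0" by linarith
    then show ?thesis by simp
  qed
  ultimately show ?thesis unfolding triangle_def by blast
qed

text \<open>Two cells meet in one point only: comparing coordinate \<open>j\<close> on both sides,
  that of \<open>x\<close> exceeds that of \<open>y\<close> by 1, so it is at least 1.\<close>

lemma F_triangle_inter:
  assumes "i \<in> {0,1,2}" "j \<in> {0,1,2}" "i \<noteq> j" "x \<in> triangle" "y \<in> triangle" "F q i x = F q j y"
  shows "x = q j"
proof -
  have b: "bary i (q i) = 1" "bary j (q j) = 1" "bary i (q j) = 0" "bary j (q i) = 0"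
    using assms(1-3) bary_vertex by auto
  have eq: "bary k x + bary k (q i) = bary k y + bary k (q j)" for k
    using bary_F[of k i x] bary_F[of k j y] assms(6) by simp
  have "bary j y \<ge> 0" using assms(2,5) by (auto simp: triangle_def)
  then have "bary j x \<ge> 1" using eq[of j] b by linarith
  with assms(2,4) show ?thesis by (intro triangle_eq_vertex)
qed

section \<open>Gluing functions along the three cells\<close>

definition glue :: "(nat \<Rightarrow> real^2 \<Rightarrow> real) \<Rightarrow> real^2 \<Rightarrow> real" where
  "glue u x = (let i = (SOME i. i \<in> {0,1,2} \<and> x \<in> F q i ` SG q) in u i (2 *\<^sub>R x - q i))"

text \<open>The common point of cells \<open>i\<close> and \<open>j\<close> is
  \<open>F q i (q j) = F q j (q i)\<close>, so the compatibility condition makes the choice of a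
  cell in \<open>glue\<close> immaterial.\<close>

lemma glue_F:
  assumes u: "\<And>i j. i \<in> {0,1,2} \<Longrightarrow> j \<in> {0,1,2} \<Longrightarrow> u i (q j) = u j (q i)"
    and i: "i \<in> {0,1,2}" and x: "x \<in> SG q"
  shows "glue u (F q i x) = u i x"
proof -
  let ?P = "\<lambda>j. j \<in> {0,1,2} \<and> F q i x \<in> F q j ` SG q"
  define j where "j = Eps ?P"
  have "?P j" unfolding j_def by (rule someI[of ?P i]) (use i x in auto)
  then obtain y where j: "j \<in> {0,1,2}" and y: "y \<in> SG q" "F q i x = F q j y" by auto
  have "glue u (F q i x) = u j (2 *\<^sub>R F q i x - q j)" unfolding glue_def j_def Let_def ..
  then have *: "glue u (F q i x) = u j y" using y(2) by simp
  show ?thesis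
  proof (cases "i = j")
    case True then show ?thesis using * y(2) by simp
  next
    case False
    have "x \<in> triangle" "y \<in> triangle" using x y(1) SG_subset_triangle by auto
    then have "x = q j" "y = q i"
      using F_triangle_inter[OF i j False] F_triangle_inter[OF j i] y(2) False by metis+
    then show ?thesis using * u[OF i j] by simp
  qed
qed

lemma continuous_on_glue:
  assumes u: "\<And>i j. i \<in> {0,1,2} \<Longrightarrow> j \<in> {0,1,2} \<Longrightarrow> u i (q j) = u j (q i)"
    and c: "\<And>i. i \<in> {0,1,2} \<Longrightarrow> continuous_on (SG q) (u i)"
  shows "continuous_on (SG q) (glue u)"
proof -
  have 1: "continuous_on (F q i ` SG q) (glue u)" if i: "i \<in> {0,1,2}" for i
  proof -
    have "continuous_on (F q i ` SG q) (\<lambda>x. u i (2 *\<^sub>R x - q i))"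
      by (rule continuous_on_compose2[OF c[OF i]]) (auto intro!: continuous_intros)
    then show ?thesis
      by (rule continuous_on_eq) (use glue_F[of u, OF u] i in auto)
  qed
  have 2: "closed (F q i ` SG q)" for i
    using compact_F_image[OF compact_SG] compact_imp_closed by blast
  have "SG q = F q 0 ` SG q \<union> F q 1 ` SG q \<union> F q 2 ` SG q"
    by (subst SG_eq) auto
  moreover have "continuous_on (F q 0 ` SG q \<union> F q 1 ` SG q \<union> F q 2 ` SG q) (glue u)"
    using 1 2 by (intro continuous_on_closed_Un closed_Un) auto
  ultimately show ?thesis by simp
qed

end

subsection \<open>Graph energies and harmonic extension\<close>

definition tri :: "real \<Rightarrow> real \<Rightarrow> real \<Rightarrow> real" where
  "tri a b c = (a - b)\<^sup>2 + (b - c)\<^sup>2 + (a - c)\<^sup>2"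

lemma finite_V: "finite (V q m)"
  by (induction m) auto

lemma F_word_V: "set w \<subseteq> {0,1,2} \<Longrightarrow> F_word q w ` V q 0 \<subseteq> V q (length w)"
proof (induction w)
  case (Cons i w)
  then have "F_word q (i # w) ` V q 0 \<subseteq> F q i ` V q (length w)" "i \<in> {0,1,2}"
    by (auto simp del: V.simps)
  then show ?case by auto
qed auto

lemma adj_in_V: "adj q m x y \<Longrightarrow> x \<in> V q m \<and> y \<in> V q m"
proof -
  assume "adj q m x y"
  then obtain w where "length w = m" "set w \<subseteq> {0,1,2}" "x \<in> F_word q w ` V q 0" "y \<in> F_word q w ` V q 0"
    unfolding adj_def by (elim conjE exE)
  then show ?thesis using F_word_V[of w q] by (metis subsetD)
qed

lemma adj_0: "adj q 0 x y \<longleftrightarrow> x \<noteq> y \<and> x \<in> V q 0 \<and> y \<in> V q 0"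
  by (auto simp: adj_def)

lemma adj_Suc:
  "adj q (Suc m) x y \<longleftrightarrow> (\<exists>i\<in>{0,1,2}. \<exists>x' y'. x = F q i x' \<and> y = F q i y' \<and> adj q m x' y')"
proof
  assume "adj q (Suc m) x y"
  then obtain w where w: "x \<noteq> y" "length w = Suc m" "set w \<subseteq> {0,1,2}"
    "x \<in> F_word q w ` V q 0" "y \<in> F_word q w ` V q 0"
    unfolding adj_def by blast
  then obtain i v where v: "w = i # v" by (cases w) auto
  obtain a b where "a \<in> V q 0" "b \<in> V q 0" "x = F q i (F_word q v a)" "y = F q i (F_word q v b)"
    using w(4,5) unfolding v by (auto simp del: V.simps)
  moreover have "i \<in> {0,1,2}" "length v = m" "set v \<subseteq> {0,1,2}" using w v by auto
  moreover have "F_word q v a \<noteq> F_word q v b" using w(1) calculation(3,4) by auto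
  ultimately show "\<exists>i\<in>{0,1,2}. \<exists>x' y'. x = F q i x' \<and> y = F q i y' \<and> adj q m x' y'"
    unfolding adj_def by blast
next
  assume "\<exists>i\<in>{0,1,2}. \<exists>x' y'. x = F q i x' \<and> y = F q i y' \<and> adj q m x' y'"
  then obtain i x' y' w where i: "i \<in> {0,1,2}" "x = F q i x'" "y = F q i y'" "x' \<noteq> y'"
    "length w = m" "set w \<subseteq> {0,1,2}" "x' \<in> F_word q w ` V q 0" "y' \<in> F_word q w ` V q 0"
    unfolding adj_def by blast
  then have "length (i # w) = Suc m" "set (i # w) \<subseteq> {0,1,2}"
    "x \<in> F_word q (i # w) ` V q 0" "y \<in> F_word q (i # w) ` V q 0"
    by (auto simp del: V.simps)
  moreover have "x \<noteq> y" using i by simp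
  ultimately show "adj q (Suc m) x y" unfolding adj_def by blast
qed

lemma finite_adj: "finite {(x, y). adj q m x y}"
  by (rule finite_subset[of _ "V q m \<times> V q m"]) (use adj_in_V finite_V in auto)

context gasket
begin

lemma V_triangle: "V q m \<subseteq> triangle"
  by (induction m) (use vertex_triangle F_triangle in auto)

lemma V_SG: "V q m \<subseteq> SG q"
  by (induction m) (use vertex_SG F_SG in auto)

lemma vertices_distinct: "q 0 \<noteq> q 1" "q 0 \<noteq> q 2" "q 1 \<noteq> q 2"
  using bary_vertex[of 0 0] bary_vertex[of 0 1] bary_vertex[of 0 2] bary_vertex[of 1 1]
    bary_vertex[of 1 2] by auto

text \<open>No edge is counted twice: an edge lying in two cells would have both its endpoints at
  their single common point.\<close>

lemma graph_energy_Suc: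
  "graph_energy q (Suc m) u = (\<Sum>i\<in>{0,1,2}. graph_energy q m (u \<circ> F q i))"
proof -
  let ?E = "\<lambda>m. {(x, y). adj q m x y}" and ?f = "\<lambda>i. map_prod (F q i) (F q i)"
  let ?g = "\<lambda>u (x, y). (u x - u y)\<^sup>2 :: real"
  have E: "?E (Suc m) = (\<Union>i\<in>{0,1,2}. ?f i ` ?E m)"
    unfolding adj_Suc by (auto simp: image_iff)
  have disj: "?f i ` ?E m \<inter> ?f j ` ?E m = {}"
    if ij: "i \<in> {0,1,2}" "j \<in> {0,1,2}" "i \<noteq> j" for i j
  proof -
    have False if "adj q m x y" "adj q m x' y'" "F q i x = F q j x'" "F q i y = F q j y'" for x y x' y'
    proof -
      have "x \<in> triangle" "y \<in> triangle" "x' \<in> triangle" "y' \<in> triangle"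
        using that adj_in_V V_triangle by blast+
      then have "x = q j" "y = q j" using F_triangle_inter[OF ij] that by blast+
      with that(1) show False by (simp add: adj_def)
    qed
    then show ?thesis by fastforce
  qed
  have inj: "inj_on (?f i) (?E m)" for i
    by (auto simp: inj_on_def)
  have "sum (?g u) (?E (Suc m)) = (\<Sum>i\<in>{0,1,2}. sum (?g u) (?f i ` ?E m))"
    unfolding E by (rule sum.UNION_disjoint) (use disj finite_adj in auto)
  also have "\<dots> = (\<Sum>i\<in>{0,1,2}. sum (?g (u \<circ> F q i)) (?E m))"
    by (intro sum.cong[OF refl]) (subst sum.reindex[OF inj], simp add: o_def case_prod_beta)
  finally show ?thesis unfolding graph_energy_def by (simp add: add_divide_distrib)
qed

lemma graph_energy_0: "graph_energy q 0 u = tri (u (q 0)) (u (q 1)) (u (q 2))"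
proof -
  have "{(x, y). adj q 0 x y} =
      {(q 0, q 1), (q 1, q 0), (q 0, q 2), (q 2, q 0), (q 1, q 2), (q 2, q 1)}"
    unfolding adj_0 using vertices_distinct by auto
  then show ?thesis
    unfolding graph_energy_def tri_def using vertices_distinct
    by (simp add: power2_commute)
qed

section \<open>Renormalised energies and their monotonicity\<close>

definition renormalized_energy :: "nat \<Rightarrow> (real^2 \<Rightarrow> real) \<Rightarrow> real" where
  "renormalized_energy m u = (5/3) ^ m * graph_energy q m u"

lemma renormalized_energy_0:
  "renormalized_energy 0 u = tri (u (q 0)) (u (q 1)) (u (q 2))"
  by (simp add: renormalized_energy_def graph_energy_0)

lemma renormalized_energy_Suc:
  "renormalized_energy (Suc m) u = 5/3 * (renormalized_energy m (u \<circ> F q 0) +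
     renormalized_energy m (u \<circ> F q 1) + renormalized_energy m (u \<circ> F q 2))"
  by (simp add: renormalized_energy_def graph_energy_Suc algebra_simps)

lemma renormalized_energy_cong:
  assumes "\<And>x. x \<in> SG q \<Longrightarrow> u x = v x"
  shows "renormalized_energy m u = renormalized_energy m v"
proof -
  have "u x = v x \<and> u y = v y" if "adj q m x y" for x y
    using adj_in_V[OF that] V_SG assms by blast
  then show ?thesis
    unfolding renormalized_energy_def graph_energy_def
    by (intro arg_cong2[where f = "(*)"] arg_cong2[where f = "(/)"] sum.cong refl) auto
qed

text \<open>Completed square in the three midpoint values. The minimisers are the (2/5, 2/5, 1/5)
  averages, and 5/3 is the factor for which the minimum over the subdivided triangle equals
  \<open>tri a b c\<close>.\<close>

lemma tri_subdivide:
  "5/3 * (tri a x y + tri x b z + tri y z c) - tri a b c =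
     5/3 * (tri (x - (2*a + 2*b + c) / 5) (y - (2*a + b + 2*c) / 5) (z - (a + 2*b + 2*c) / 5) +
       2 * (x - (2*a + 2*b + c) / 5)\<^sup>2 + 2 * (y - (2*a + b + 2*c) / 5)\<^sup>2 + 2 * (z - (a + 2*b + 2*c) / 5)\<^sup>2)"
  unfolding tri_def by (simp add: field_simps power2_eq_square)

lemma tri_subdivide_harmonic:
  "5/3 * (tri a ((2*a + 2*b + c) / 5) ((2*a + b + 2*c) / 5) + tri ((2*a + 2*b + c) / 5) b ((a + 2*b + 2*c) / 5) +
     tri ((2*a + b + 2*c) / 5) ((a + 2*b + 2*c) / 5) c) = tri a b c"
  using tri_subdivide[of a "(2*a + 2*b + c) / 5" "(2*a + b + 2*c) / 5" b "(a + 2*b + 2*c) / 5" c]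
  by (simp add: tri_def)

lemma tri_nonneg: "0 \<le> tri a b c"
  by (simp add: tri_def)

text \<open>Only the first subdivision needs the completed square; later ones are the same
  inequality inside each cell.\<close>

lemma renormalized_energy_mono_Suc: "renormalized_energy m u \<le> renormalized_energy (Suc m) u"
proof (induction m arbitrary: u)
  case 0
  define x y z where "x = u (F q 0 (q 1))" and "y = u (F q 0 (q 2))" and "z = u (F q 1 (q 2))"
  have "renormalized_energy (Suc 0) u =
      5/3 * (tri (u (q 0)) x y + tri x (u (q 1)) z + tri y z (u (q 2)))"
    unfolding renormalized_energy_Suc renormalized_energy_0 x_def y_def z_def o_apply F_fixed
      F_commute[of q 1 0] F_commute[of q 2] ..
  moreover have "0 \<le> 5/3 * (tri a b c + 2 * d\<^sup>2 + 2 * e\<^sup>2 + 2 * f\<^sup>2)" for a b c d e f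
    using tri_nonneg[of a b c] by simp
  ultimately show ?case
    unfolding renormalized_energy_0 using tri_subdivide[of "u (q 0)" x y "u (q 1)" z "u (q 2)"]
    by (metis diff_ge_0_iff_ge)
next
  case (Suc m)
  show ?case
    unfolding renormalized_energy_Suc[of "Suc m" u] renormalized_energy_Suc[of m u]
    by (intro mult_left_mono add_mono Suc) simp
qed

lemma renormalized_energy_mono: "m \<le> n \<Longrightarrow> renormalized_energy m u \<le> renormalized_energy n u"
  by (rule lift_Suc_mono_le[of "\<lambda>m. renormalized_energy m u"]) (rule renormalized_energy_mono_Suc)

lemma energy_eq_SUP: "energy q u = (SUP m. ereal (renormalized_energy m u))"
proof -
  have "(\<lambda>m. ereal (renormalized_energy m u)) \<longlonglongrightarrow> (SUP m. ereal (renormalized_energy m u))"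
    by (intro LIMSEQ_SUP incseq_SucI) (simp add: renormalized_energy_mono_Suc)
  then show ?thesis unfolding energy_def renormalized_energy_def by (rule limI)
qed

lemma renormalized_energy_le_energy: "ereal (renormalized_energy m u) \<le> energy q u"
  unfolding energy_eq_SUP by (rule SUP_upper) simp

lemma energy_eventually_const:
  assumes "\<And>m. n \<le> m \<Longrightarrow> renormalized_energy m u = c"
  shows "energy q u = ereal c"
proof (rule antisym)
  have "renormalized_energy m u \<le> c" for m
    using renormalized_energy_mono[of m "max m n" u] assms[of "max m n"] by simp
  then show "energy q u \<le> ereal c" unfolding energy_eq_SUP by (intro SUP_least) simp
  show "ereal c \<le> energy q u" using renormalized_energy_le_energy[of n u] assms[of n] by simp
qed

section \<open>Construction of the harmonic extension\<close>

definition glue3 :: "(real^2 \<Rightarrow> real) \<Rightarrow> (real^2 \<Rightarrow> real) \<Rightarrow> (real^2 \<Rightarrow> real) \<Rightarrow> real^2 \<Rightarrow> real" where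
  "glue3 u v w = glue (\<lambda>i. if i = 0 then u else if i = 1 then v else w)"

lemma glue3_compat:
  assumes "u (q 1) = v (q 0)" "u (q 2) = w (q 0)" "v (q 2) = w (q 1)" "i \<in> {0,1,2}" "j \<in> {0,1,2}"
  defines "U \<equiv> \<lambda>i::nat. if i = 0 then u else if i = 1 then v else w"
  shows "U i (q j) = U j (q i)"
  using assms(1-5) unfolding U_def by (elim insertE emptyE) simp_all

lemma glue3_F:
  assumes "u (q 1) = v (q 0)" "u (q 2) = w (q 0)" "v (q 2) = w (q 1)" "x \<in> SG q"
  shows "glue3 u v w (F q 0 x) = u x" "glue3 u v w (F q 1 x) = v x" "glue3 u v w (F q 2 x) = w x"
  using glue_F[where u = "\<lambda>i. if i = 0 then u else if i = 1 then v else w",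
      OF glue3_compat[OF assms(1-3)], where x = x] assms(4)
  unfolding glue3_def by simp_all

lemma glue3_vertex:
  assumes "u (q 1) = v (q 0)" "u (q 2) = w (q 0)" "v (q 2) = w (q 1)"
  shows "glue3 u v w (q 0) = u (q 0)" "glue3 u v w (q 1) = v (q 1)" "glue3 u v w (q 2) = w (q 2)"
  using glue3_F(1)[OF assms, of "q 0"] glue3_F(2)[OF assms, of "q 1"] glue3_F(3)[OF assms, of "q 2"]
    vertex_SG by auto

lemma continuous_on_glue3:
  assumes "u (q 1) = v (q 0)" "u (q 2) = w (q 0)" "v (q 2) = w (q 1)"
    "continuous_on (SG q) u" "continuous_on (SG q) v" "continuous_on (SG q) w"
  shows "continuous_on (SG q) (glue3 u v w)"
  unfolding glue3_def
  by (rule continuous_on_glue[where u = "\<lambda>i. if i = 0 then u else if i = 1 then v else w",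
        OF glue3_compat[OF assms(1-3)]])
    (use assms(4-6) in auto)

lemma renormalized_energy_glue3:
  assumes "u (q 1) = v (q 0)" "u (q 2) = w (q 0)" "v (q 2) = w (q 1)"
  shows "renormalized_energy (Suc m) (glue3 u v w) =
    5/3 * (renormalized_energy m u + renormalized_energy m v + renormalized_energy m w)"
proof -
  have "renormalized_energy m (glue3 u v w \<circ> F q 0) = renormalized_energy m u"
    "renormalized_energy m (glue3 u v w \<circ> F q 1) = renormalized_energy m v"
    "renormalized_energy m (glue3 u v w \<circ> F q 2) = renormalized_energy m w"
    by (rule renormalized_energy_cong, simp only: o_apply glue3_F[OF assms])+
  then show ?thesis by (simp add: renormalized_energy_Suc)
qed

text \<open>The function with the harmonic values on level \<open>k\<close> and affine interpolation
  in barycentric coordinates inside the cells. The boundary values are arguments because they change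
  in the recursion.\<close>

primrec harm_approx :: "nat \<Rightarrow> real \<Rightarrow> real \<Rightarrow> real \<Rightarrow> real^2 \<Rightarrow> real" where
  "harm_approx 0 = (\<lambda>a b c x. a * bary 0 x + b * bary 1 x + c * bary 2 x)"
| "harm_approx (Suc k) = (\<lambda>a b c. glue3
     (harm_approx k a ((2*a + 2*b + c) / 5) ((2*a + b + 2*c) / 5))
     (harm_approx k ((2*a + 2*b + c) / 5) b ((a + 2*b + 2*c) / 5))
     (harm_approx k ((2*a + b + 2*c) / 5) ((a + 2*b + 2*c) / 5) c))"

lemma harm_approx_vertex:
  "harm_approx k a b c (q 0) = a \<and> harm_approx k a b c (q 1) = b \<and> harm_approx k a b c (q 2) = c"
proof (induction k arbitrary: a b c)
  case 0
  then show ?case using bary_vertex[of 0 0] bary_vertex[of 0 1] bary_vertex[of 0 2] bary_vertex[of 1 0]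
    bary_vertex[of 1 1] bary_vertex[of 1 2] bary_vertex[of 2 0] bary_vertex[of 2 1] bary_vertex[of 2 2]
    by simp
next
  case (Suc k)
  show ?case unfolding harm_approx.simps(2)
    by (intro conjI; subst glue3_vertex) (simp_all only: Suc)
qed

lemma harm_approx_F:
  assumes "x \<in> SG q"
  shows "harm_approx (Suc k) a b c (F q 0 x) = harm_approx k a ((2*a + 2*b + c) / 5) ((2*a + b + 2*c) / 5) x"
    "harm_approx (Suc k) a b c (F q 1 x) = harm_approx k ((2*a + 2*b + c) / 5) b ((a + 2*b + 2*c) / 5) x"
    "harm_approx (Suc k) a b c (F q 2 x) = harm_approx k ((2*a + b + 2*c) / 5) ((a + 2*b + 2*c) / 5) c x"
  unfolding harm_approx.simps(2) by (subst glue3_F; simp only: harm_approx_vertex assms)+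

lemma continuous_on_harm_approx: "continuous_on (SG q) (harm_approx k a b c)"
proof (induction k arbitrary: a b c)
  case 0
  then show ?case unfolding harm_approx.simps by (intro continuous_intros)
next
  case (Suc k)
  show ?case unfolding harm_approx.simps(2)
    by (rule continuous_on_glue3) (simp_all only: Suc harm_approx_vertex)
qed

text \<open>Passing to a cell shrinks the spread of the boundary values by 3/5: for example
  \<open>a - (2*a + 2*b + c) / 5\<close> is a fifth of \<open>2 * (a - b) + (a - c)\<close>. Two
  consecutive approximations differ only inside cells of level \<open>k\<close>.\<close>

lemma harm_approx_diff:
  assumes "x \<in> SG q" "\<bar>a - b\<bar> \<le> D" "\<bar>a - c\<bar> \<le> D" "\<bar>b - c\<bar> \<le> D"
  shows "\<bar>harm_approx (Suc k) a b c x - harm_approx k a b c x\<bar> \<le> (3/5) ^ k * D"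
  using assms
proof (induction k arbitrary: a b c x D)
  case 0
  obtain i y where y: "i \<in> {0,1,2}" "y \<in> SG q" "x = F q i y" using 0(1) by (rule SG_cases)
  have b: "0 \<le> bary 0 y" "0 \<le> bary 1 y" "0 \<le> bary 2 y"
    using y(2) SG_subset_triangle by (auto simp: triangle_def)
  have b0: "bary 0 y = 1 - bary 1 y - bary 2 y" using sum_bary[of y] by linarith
  have est: "\<bar>s * r + t * r'\<bar> \<le> D" if "0 \<le> r" "0 \<le> r'" "r + r' \<le> 1" "\<bar>s\<bar> \<le> D" "\<bar>t\<bar> \<le> D" for s t r r'
  proof -
    have "\<bar>s * r + t * r'\<bar> \<le> \<bar>s\<bar> * r + \<bar>t\<bar> * r'"
      using that abs_triangle_ineq[of "s * r" "t * r'"] by (simp add: abs_mult)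
    also have "\<dots> \<le> D * r + D * r'" using that by (intro add_mono mult_right_mono) auto
    also have "\<dots> \<le> D * 1" unfolding distrib_left[symmetric] using that by (intro mult_left_mono) auto
    finally show ?thesis by simp
  qed
  have v: "bary i (q j) = (if i = j then 1 else 0)" if "i \<in> {0,1,2}" "j \<in> {0,1,2}" for i j
    using bary_vertex that by simp
  consider "i = 0" | "i = 1" | "i = 2" using y(1) by auto
  then show ?case
  proof cases
    case 1
    \<comment> \<open>The difference is affine on the cell and zero at its outer corner; the
      coefficients are the harmonic value minus the average of two endpoints, as in
      \<open>(2*a + 2*b + c) / 5 - (a + b) / 2\<close>.\<close>
    have *: "harm_approx (Suc 0) a b c x - harm_approx 0 a b c x =
        (2*c - a - b) / 10 * bary 1 y + (2*b - a - c) / 10 * bary 2 y"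
      unfolding y(3) 1 harm_approx_F[OF y(2)] harm_approx.simps(1) bary_F
      by (simp only: v insert_iff simp_thms) (simp add: b0 field_simps)
    show ?thesis unfolding * power_0 mult_1
      using b sum_bary[of y] 0(2-4)[unfolded abs_le_iff] by (intro est) (simp_all add: abs_le_iff)
  next
    case 2
    have *: "harm_approx (Suc 0) a b c x - harm_approx 0 a b c x =
        (2*c - a - b) / 10 * bary 0 y + (2*a - b - c) / 10 * bary 2 y"
      unfolding y(3) 2 harm_approx_F[OF y(2)] harm_approx.simps(1) bary_F
      by (simp only: v insert_iff simp_thms) (simp add: b0 field_simps)
    show ?thesis unfolding * power_0 mult_1
      using b sum_bary[of y] 0(2-4)[unfolded abs_le_iff] by (intro est) (simp_all add: abs_le_iff)
  next
    case 3
    have *: "harm_approx (Suc 0) a b c x - harm_approx 0 a b c x =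
        (2*b - a - c) / 10 * bary 0 y + (2*a - b - c) / 10 * bary 1 y"
      unfolding y(3) 3 harm_approx_F[OF y(2)] harm_approx.simps(1) bary_F
      by (simp only: v insert_iff simp_thms) (simp add: b0 field_simps)
    show ?thesis unfolding * power_0 mult_1
      using b sum_bary[of y] 0(2-4)[unfolded abs_le_iff] by (intro est) (simp_all add: abs_le_iff)
  qed
next
  case (Suc k)
  obtain i y where y: "i \<in> {0,1,2}" "y \<in> SG q" "x = F q i y" using Suc.prems(1) by (rule SG_cases)
  have IH: "\<bar>harm_approx (Suc k) a' b' c' y - harm_approx k a' b' c' y\<bar> \<le> (3/5) ^ Suc k * D"
    if "\<bar>a' - b'\<bar> \<le> 3/5 * D" "\<bar>a' - c'\<bar> \<le> 3/5 * D" "\<bar>b' - c'\<bar> \<le> 3/5 * D" for a' b' c'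
    using Suc.IH[OF y(2) that] by (simp add: ac_simps)
  consider "i = 0" | "i = 1" | "i = 2" using y(1) by auto
  then show ?case
  proof cases
    case 1
    show ?thesis unfolding y(3) 1 harm_approx_F[OF y(2)]
      by (rule IH; rule abs_leI; use Suc.prems(2-4)[unfolded abs_le_iff] in \<open>simp add: field_simps\<close>)
  next
    case 2
    show ?thesis unfolding y(3) 2 harm_approx_F[OF y(2)]
      by (rule IH; rule abs_leI; use Suc.prems(2-4)[unfolded abs_le_iff] in \<open>simp add: field_simps\<close>)
  next
    case 3
    show ?thesis unfolding y(3) 3 harm_approx_F[OF y(2)]
      by (rule IH; rule abs_leI; use Suc.prems(2-4)[unfolded abs_le_iff] in \<open>simp add: field_simps\<close>)
  qed
qed

theorem harmonic_extension:
  obtains h where "continuous_on (SG q) h" "h (q 0) = a" "h (q 1) = b" "h (q 2) = c"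
    "\<And>m. renormalized_energy m h = tri a b c"
proof -
  \<comment> \<open>One limit function for all boundary values at once, so that the recursion of
    \<open>harm_approx\<close> passes to the limit.\<close>
  define H where "H a b c x = lim (\<lambda>k. harm_approx k a b c x)" for a b c x
  have unif: "uniform_limit (SG q) (\<lambda>k. harm_approx k a b c) (H a b c) sequentially" for a b c
  proof -
    define D where "D = \<bar>a - b\<bar> + \<bar>a - c\<bar> + \<bar>b - c\<bar>"
    let ?f = "\<lambda>k x. harm_approx (Suc k) a b c x - harm_approx k a b c x"
    \<comment> \<open>The approximations are partial sums of their differences, which a geometric
      series of ratio 3/5 dominates.\<close>
    have "uniform_limit (SG q) (\<lambda>n x. \<Sum>k<n. ?f k x) (\<lambda>x. \<Sum>k. ?f k x) sequentially"
    proof (rule Weierstrass_m_test)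
      show "norm (?f k x) \<le> (3/5) ^ k * D" if "x \<in> SG q" for k x
        unfolding real_norm_def by (rule harm_approx_diff[OF that]) (auto simp: D_def)
      show "summable (\<lambda>k. (3/5) ^ k * D)" by (intro summable_mult2 summable_geometric) simp
    qed
    then have "uniform_limit (SG q) (\<lambda>n x. harm_approx 0 a b c x + (\<Sum>k<n. ?f k x))
        (\<lambda>x. harm_approx 0 a b c x + (\<Sum>k. ?f k x)) sequentially"
      by (intro uniform_limit_add uniform_limit_const)
    moreover have "(\<Sum>k<n. ?f k x) = harm_approx n a b c x - harm_approx 0 a b c x" for n x
      by (rule sum_lessThan_telescope)
    ultimately have *: "uniform_limit (SG q) (\<lambda>n. harm_approx n a b c)
        (\<lambda>x. harm_approx 0 a b c x + (\<Sum>k. ?f k x)) sequentially" by simp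
    have "harm_approx 0 a b c x + (\<Sum>k. ?f k x) = H a b c x" if "x \<in> SG q" for x
      unfolding H_def using tendsto_uniform_limitI[OF * that] by (rule limI[symmetric])
    with * show ?thesis by (simp cong: uniform_limit_cong')
  qed
  have cont: "continuous_on (SG q) (H a b c)" for a b c
    by (rule uniform_limit_theorem[OF _ unif]) (auto intro!: always_eventually continuous_on_harm_approx)
  have lim: "(\<lambda>k. harm_approx k a b c x) \<longlonglongrightarrow> H a b c x" if "x \<in> SG q" for a b c x
    using tendsto_uniform_limitI[OF unif that] .
  have vert: "H a b c (q 0) = a" "H a b c (q 1) = b" "H a b c (q 2) = c" for a b c
    unfolding H_def by (simp_all only: harm_approx_vertex lim_const)
  have HF: "H a b c (F q 0 x) = H a ((2*a + 2*b + c) / 5) ((2*a + b + 2*c) / 5) x"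
      "H a b c (F q 1 x) = H ((2*a + 2*b + c) / 5) b ((a + 2*b + 2*c) / 5) x"
      "H a b c (F q 2 x) = H ((2*a + b + 2*c) / 5) ((a + 2*b + 2*c) / 5) c x"
    if x: "x \<in> SG q" for a b c x
  proof -
    have 1: "(\<lambda>k. harm_approx (Suc k) a b c (F q i x)) \<longlonglongrightarrow> H a b c (F q i x)" if "i \<in> {0,1,2}" for i
      by (rule LIMSEQ_Suc[OF lim[OF F_SG[OF that x]]])
    show "H a b c (F q 0 x) = H a ((2*a + 2*b + c) / 5) ((2*a + b + 2*c) / 5) x"
      using LIMSEQ_unique[OF 1[of 0, unfolded harm_approx_F[OF x]] lim[OF x]] by blast
    show "H a b c (F q 1 x) = H ((2*a + 2*b + c) / 5) b ((a + 2*b + 2*c) / 5) x"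
      using LIMSEQ_unique[OF 1[of 1, unfolded harm_approx_F[OF x]] lim[OF x]] by blast
    show "H a b c (F q 2 x) = H ((2*a + b + 2*c) / 5) ((a + 2*b + 2*c) / 5) c x"
      using LIMSEQ_unique[OF 1[of 2, unfolded harm_approx_F[OF x]] lim[OF x]] by blast
  qed
  have "renormalized_energy m (H a b c) = tri a b c" for m a b c
  proof (induction m arbitrary: a b c)
    case 0
    then show ?case by (simp only: renormalized_energy_0 vert)
  next
    case (Suc m)
    have "renormalized_energy (Suc m) (H a b c) = 5/3 *
       (renormalized_energy m (H a ((2*a + 2*b + c) / 5) ((2*a + b + 2*c) / 5)) +
        renormalized_energy m (H ((2*a + 2*b + c) / 5) b ((a + 2*b + 2*c) / 5)) +
        renormalized_energy m (H ((2*a + b + 2*c) / 5) ((a + 2*b + 2*c) / 5) c))"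
      unfolding renormalized_energy_Suc
      by (intro arg_cong2[where f = "(*)"] arg_cong2[where f = "(+)"] refl renormalized_energy_cong)
        (simp_all only: o_apply HF)
    then show ?case unfolding Suc tri_subdivide_harmonic .
  qed
  then show thesis using that[of "H a b c"] cont vert by blast
qed

end

subsection \<open>Eliminating inner vertices\<close>

lemma sum_weighted_square_diff:
  fixes x g :: "'a \<Rightarrow> real"
  shows "(\<Sum>i\<in>I. x i * (s - g i)\<^sup>2) = s\<^sup>2 * sum x I - 2 * s * (\<Sum>i\<in>I. x i * g i) + (\<Sum>i\<in>I. x i * (g i)\<^sup>2)"
proof -
  have "x i * (s - g i)\<^sup>2 = s\<^sup>2 * x i - 2 * s * (x i * g i) + x i * (g i)\<^sup>2" for i
    by (simp add: power2_eq_square algebra_simps)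
  then show ?thesis by (simp only: sum.distrib sum_subtractf sum_distrib_left)
qed

lemma sum_product_square_diff:
  fixes x y g :: "'a \<Rightarrow> real"
  shows "(\<Sum>i\<in>I. \<Sum>j\<in>I. x i * y j * (g i - g j)\<^sup>2) =
    (\<Sum>i\<in>I. x i * (g i)\<^sup>2) * sum y I - 2 * (\<Sum>i\<in>I. x i * g i) * (\<Sum>j\<in>I. y j * g j) +
    sum x I * (\<Sum>j\<in>I. y j * (g j)\<^sup>2)"
proof -
  have "(\<Sum>j\<in>I. x i * y j * (g i - g j)\<^sup>2) = x i * (g i)\<^sup>2 * sum y I -
      2 * (x i * g i) * (\<Sum>j\<in>I. y j * g j) + x i * (\<Sum>j\<in>I. y j * (g j)\<^sup>2)" for i
    unfolding mult.assoc sum_distrib_left[symmetric] sum_weighted_square_diff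
    by (simp add: algebra_simps)
  then show ?thesis
    by (simp only: sum.distrib sum_subtractf sum_distrib_right[symmetric] sum_distrib_left[symmetric])
qed

text \<open>A Schur complement. The vertices with values \<open>a\<close> and \<open>b\<close> are
  joined to each other, to \<open>t\<close>, and by \<open>L\<close> and \<open>R\<close> to the
  row; their matrix has diagonal entries \<open>2 + T\<close>, off-diagonal entries -1 and
  determinant \<open>(1 + T) * (3 + T)\<close>. Its inverse applied to (1, 1) gives the factor
  \<open>1 / (1 + T)\<close> at the top. \<open>A\<close> and \<open>B\<close> are the minimising
  values, and the last bracket is the quadratic form of the deviation from them.\<close>

lemma eliminate_two_nodes:
  fixes L R g :: "'a \<Rightarrow> real" and T t :: real
  assumes T: "sum L I = T" "sum R I = T" "0 \<le> T"
  defines "P \<equiv> \<Sum>i\<in>I. L i * g i" and "S \<equiv> \<Sum>i\<in>I. R i * g i"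
  defines "A \<equiv> ((2 + T) * (t + P) + (t + S)) / ((1 + T) * (3 + T))"
    and "B \<equiv> ((2 + T) * (t + S) + (t + P)) / ((1 + T) * (3 + T))"
  shows "tri t a b + (\<Sum>i\<in>I. L i * (a - g i)\<^sup>2) + (\<Sum>i\<in>I. R i * (b - g i)\<^sup>2) =
    (\<Sum>i\<in>I. (L i + R i) / (1 + T) * (t - g i)\<^sup>2) +
    (\<Sum>i\<in>I. \<Sum>j\<in>I. ((2 + T) * (L i * L j + R i * R j) + (L i * R j + R i * L j)) /
       ((1 + T) * (3 + T)) * (g i - g j)\<^sup>2) / 2 +
    ((a - A - (b - B))\<^sup>2 + (1 + T) * ((a - A)\<^sup>2 + (b - B)\<^sup>2))"
proof -
  define D where "D = (1 + T) * (3 + T)"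
  define P2 S2 where "P2 = (\<Sum>i\<in>I. L i * (g i)\<^sup>2)" and "S2 = (\<Sum>i\<in>I. R i * (g i)\<^sup>2)"
  have nz: "1 + T \<noteq> 0" "3 + T \<noteq> 0" "D \<noteq> 0" using T(3) by (auto simp: D_def)
  \<comment> \<open>The equations for a stationary point in \<open>a\<close> and
    \<open>b\<close>.\<close>
  have A: "(2 + T) * A - B = t + P"
    using nz unfolding A_def B_def by (simp add: divide_simps) (simp add: algebra_simps power2_eq_square)
  have B: "(2 + T) * B - A = t + S"
    using nz unfolding A_def B_def by (simp add: divide_simps) (simp add: algebra_simps power2_eq_square)
  have AB: "A * (t + P) + B * (t + S) = ((2 + T) * ((t + P)\<^sup>2 + (t + S)\<^sup>2) + 2 * (t + P) * (t + S)) / D"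
    unfolding A_def B_def D_def by (simp add: add_divide_distrib[symmetric] power2_eq_square algebra_simps)
  have 1: "(\<Sum>i\<in>I. L i * (a - g i)\<^sup>2) = a\<^sup>2 * T - 2 * a * P + P2"
    "(\<Sum>i\<in>I. R i * (b - g i)\<^sup>2) = b\<^sup>2 * T - 2 * b * S + S2"
    unfolding sum_weighted_square_diff T P_def S_def P2_def S2_def by simp_all
  have 2: "(\<Sum>i\<in>I. (L i + R i) / (1 + T) * (t - g i)\<^sup>2) =
      (2 * T * t\<^sup>2 - 2 * t * (P + S) + P2 + S2) / (1 + T)"
  proof -
    have "(\<Sum>i\<in>I. (L i + R i) / (1 + T) * (t - g i)\<^sup>2) =
        ((\<Sum>i\<in>I. L i * (t - g i)\<^sup>2) + (\<Sum>i\<in>I. R i * (t - g i)\<^sup>2)) / (1 + T)"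
      by (simp add: sum_divide_distrib sum.distrib[symmetric] distrib_right)
    then show ?thesis
      unfolding sum_weighted_square_diff T P_def[symmetric] S_def[symmetric] P2_def[symmetric] S2_def[symmetric]
      by (simp add: algebra_simps)
  qed
  have 3: "(\<Sum>i\<in>I. \<Sum>j\<in>I. ((2 + T) * (L i * L j + R i * R j) + (L i * R j + R i * L j)) / D * (g i - g j)\<^sup>2) / 2 =
      ((2 + T) * (T * P2 - P\<^sup>2 + T * S2 - S\<^sup>2) + (T * P2 + T * S2 - 2 * P * S)) / D"
  proof -
    let ?f = "\<lambda>x y. \<Sum>i\<in>I. \<Sum>j\<in>I. x i * y j * (g i - g j)\<^sup>2"
    have "(\<Sum>i\<in>I. \<Sum>j\<in>I. ((2 + T) * (L i * L j + R i * R j) + (L i * R j + R i * L j)) / D * (g i - g j)\<^sup>2) =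
       ((2 + T) * (?f L L + ?f R R) + (?f L R + ?f R L)) / D"
      by (simp add: sum_divide_distrib sum.distrib[symmetric] sum_distrib_left algebra_simps add_divide_distrib)
    also have "(2 + T) * (?f L L + ?f R R) + (?f L R + ?f R L) =
        2 * ((2 + T) * (T * P2 - P\<^sup>2 + T * S2 - S\<^sup>2) + (T * P2 + T * S2 - 2 * P * S))"
      unfolding sum_product_square_diff T P_def[symmetric] S_def[symmetric] P2_def[symmetric] S2_def[symmetric]
      by (simp add: algebra_simps power2_eq_square)
    finally have *: "(\<Sum>i\<in>I. \<Sum>j\<in>I. ((2 + T) * (L i * L j + R i * R j) + (L i * R j + R i * L j)) / D * (g i - g j)\<^sup>2) =
      2 * ((2 + T) * (T * P2 - P\<^sup>2 + T * S2 - S\<^sup>2) + (T * P2 + T * S2 - 2 * P * S)) / D" .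
    have "2 * m / D / 2 = m / D" for m :: real by simp
    then show ?thesis unfolding * .
  qed
  \<comment> \<open>The left side is the value of the form at \<open>a = A\<close>,
    \<open>b = B\<close>; the right side is the network without the two vertices.\<close>
  have 4: "2 * t\<^sup>2 + P2 + S2 - ((2 + T) * ((t + P)\<^sup>2 + (t + S)\<^sup>2) + 2 * (t + P) * (t + S)) / D =
      (2 * T * t\<^sup>2 - 2 * t * (P + S) + P2 + S2) / (1 + T) +
      ((2 + T) * (T * P2 - P\<^sup>2 + T * S2 - S\<^sup>2) + (T * P2 + T * S2 - 2 * P * S)) / D"
  proof -
    have x: "(2 * T * t\<^sup>2 - 2 * t * (P + S) + P2 + S2) / (1 + T) =
       (2 * T * t\<^sup>2 - 2 * t * (P + S) + P2 + S2) * (3 + T) / D"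
      using nz by (simp add: D_def)
    show ?thesis unfolding x using nz
      by (simp add: divide_simps) (simp add: D_def algebra_simps power2_eq_square)
  qed
  have "tri t a b + (a\<^sup>2 * T - 2 * a * P + P2) + (b\<^sup>2 * T - 2 * b * S + S2) =
      2 * t\<^sup>2 + P2 + S2 + ((2 + T) * (a\<^sup>2 + b\<^sup>2) - 2 * a * b - 2 * a * (t + P) - 2 * b * (t + S))"
    by (simp add: tri_def power2_eq_square algebra_simps)
  also have "(2 + T) * (a\<^sup>2 + b\<^sup>2) - 2 * a * b - 2 * a * (t + P) - 2 * b * (t + S) =
      ((a - A - (b - B))\<^sup>2 + (1 + T) * ((a - A)\<^sup>2 + (b - B)\<^sup>2)) - (A * (t + P) + B * (t + S))"
    unfolding A[symmetric] B[symmetric] by (simp add: power2_eq_square algebra_simps)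
  finally show ?thesis
    unfolding 1 2 3[unfolded D_def] AB using 4[unfolded D_def] unfolding D_def by linarith
qed

text \<open>
  \<open>top_cond n i\<close> and \<open>row_cond n i j\<close> are the conductances of level \<open>n\<close> between \<open>q\<^sub>0\<close> and \<open>x\<^sub>i\<close>, and
  between \<open>x\<^sub>i\<close> and \<open>x\<^sub>j\<close>. They vanish for indices above \<open>2 ^ n\<close>, so the left half of the next level
  needs no case distinction and the right half is the shift by \<open>2 ^ n\<close>. The values
  \<open>row_cond n i i\<close> are irrelevant.
\<close>

definition shift :: "nat \<Rightarrow> (nat \<Rightarrow> real) \<Rightarrow> nat \<Rightarrow> real" where
  "shift N f i = (if N \<le> i then f (i - N) else 0)"

primrec top_cond :: "nat \<Rightarrow> nat \<Rightarrow> real" where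
  "top_cond 0 = (\<lambda>i. if i \<le> 1 then 1 else 0)"
| "top_cond (Suc n) = (\<lambda>i. 5/3 * ((top_cond n i + shift (2 ^ n) (top_cond n) i) /
     (1 + (\<Sum>i\<le>2 ^ n. top_cond n i))))"

definition top_sum :: "nat \<Rightarrow> real" where
  "top_sum n = (\<Sum>i\<le>2 ^ n. top_cond n i)"

primrec row_cond :: "nat \<Rightarrow> nat \<Rightarrow> nat \<Rightarrow> real" where
  "row_cond 0 = (\<lambda>i j. if i \<le> 1 \<and> j \<le> 1 then 1 else 0)"
| "row_cond (Suc n) = (\<lambda>i j. 5/3 * (row_cond n i j + shift (2 ^ n) (\<lambda>i. shift (2 ^ n) (row_cond n i) j) i +
     ((2 + top_sum n) * (top_cond n i * top_cond n j +
         shift (2 ^ n) (top_cond n) i * shift (2 ^ n) (top_cond n) j) +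
       (top_cond n i * shift (2 ^ n) (top_cond n) j + shift (2 ^ n) (top_cond n) i * top_cond n j)) /
     ((1 + top_sum n) * (3 + top_sum n))))"

text \<open>The candidate for the least energy with value \<open>t\<close> at the top and
  \<open>g i\<close> at the bottom points. The double sum runs over ordered pairs, hence the
  half.\<close>

definition trace_form :: "nat \<Rightarrow> real \<Rightarrow> (nat \<Rightarrow> real) \<Rightarrow> real" where
  "trace_form n t g = (\<Sum>i\<le>2 ^ n. top_cond n i * (t - g i)\<^sup>2) +
     (\<Sum>i\<le>2 ^ n. \<Sum>j\<le>2 ^ n. row_cond n i j * (g i - g j)\<^sup>2) / 2"

lemma top_cond_Suc:
  "top_cond (Suc n) i = 5/3 * ((top_cond n i + shift (2 ^ n) (top_cond n) i) / (1 + top_sum n))"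
  by (simp add: top_sum_def)

lemma top_cond_nonneg: "0 \<le> top_cond n i"
  by (induction n arbitrary: i) (auto simp: shift_def intro!: divide_nonneg_nonneg add_nonneg_nonneg sum_nonneg)

lemma top_sum_nonneg: "0 \<le> top_sum n"
  unfolding top_sum_def by (intro sum_nonneg top_cond_nonneg)

lemma top_cond_outside: "2 ^ n < i \<Longrightarrow> top_cond n i = 0"
  by (induction n arbitrary: i) (auto simp: shift_def)

lemma row_cond_outside: "2 ^ n < i \<or> 2 ^ n < j \<Longrightarrow> row_cond n i j = 0"
proof (induction n arbitrary: i j)
  case (Suc n)
  then have "row_cond n i j = 0" "row_cond n (i - 2 ^ n) (j - 2 ^ n) = 0"
    by (auto intro!: Suc.IH)
  moreover have "top_cond n i = 0 \<and> shift (2 ^ n) (top_cond n) i = 0 \<or>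
      top_cond n j = 0 \<and> shift (2 ^ n) (top_cond n) j = 0"
    using Suc.prems by (auto simp: shift_def top_cond_outside)
  ultimately show ?case by (auto simp: shift_def)
qed auto

lemma row_cond_commute: "row_cond n i j = row_cond n j i"
  by (induction n arbitrary: i j) (auto simp: shift_def algebra_simps)

lemma trace_form_cong: "(\<And>i. i \<le> 2 ^ n \<Longrightarrow> g i = h i) \<Longrightarrow> trace_form n t g = trace_form n t h"
  by (simp add: trace_form_def)

lemma sum_shift:
  fixes f h :: "nat \<Rightarrow> real"
  shows "(\<Sum>i\<le>2 * N. shift N f i * h i) = (\<Sum>i\<le>N. f i * h (i + N))"
proof -
  have "(\<Sum>i\<le>2 * N. shift N f i * h i) = (\<Sum>i\<in>{0 + N..N + N}. shift N f i * h i)"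
    by (rule sum.mono_neutral_right) (auto simp: shift_def)
  also have "\<dots> = (\<Sum>i\<in>{0..N}. shift N f (i + N) * h (i + N))"
    by (rule sum.shift_bounds_cl_nat_ivl)
  also have "\<dots> = (\<Sum>i\<le>N. f i * h (i + N))"
    by (simp add: shift_def atLeast0AtMost)
  finally show ?thesis .
qed

lemma sum_extend:
  fixes f h :: "nat \<Rightarrow> real"
  assumes "\<And>i. N < i \<Longrightarrow> f i = 0"
  shows "(\<Sum>i\<le>2 * N. f i * h i) = (\<Sum>i\<le>N. f i * h i)"
  by (rule sum.mono_neutral_right) (auto simp: assms)

text \<open>Padding with zeros to the index range of the next level lets the two halves be added
  term by term.\<close>

lemma trace_form_left:
  "trace_form n a g = (\<Sum>i\<le>2 ^ Suc n. top_cond n i * (a - g i)\<^sup>2) +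
     (\<Sum>i\<le>2 ^ Suc n. \<Sum>j\<le>2 ^ Suc n. row_cond n i j * (g i - g j)\<^sup>2) / 2"
proof -
  have "(\<Sum>i\<le>2 ^ Suc n. \<Sum>j\<le>2 ^ Suc n. row_cond n i j * (g i - g j)\<^sup>2) =
     (\<Sum>i\<le>2 ^ n. \<Sum>j\<le>2 ^ Suc n. row_cond n i j * (g i - g j)\<^sup>2)"
    by (rule sum.mono_neutral_right) (auto simp: row_cond_outside)
  also have "\<dots> = (\<Sum>i\<le>2 ^ n. \<Sum>j\<le>2 ^ n. row_cond n i j * (g i - g j)\<^sup>2)"
    by (intro sum.cong refl sum.mono_neutral_right) (auto simp: row_cond_outside)
  finally show ?thesis
    by (simp add: trace_form_def sum_extend top_cond_outside)
qed

lemma trace_form_right: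
  "trace_form n b (\<lambda>i. g (i + 2 ^ n)) = (\<Sum>i\<le>2 ^ Suc n. shift (2 ^ n) (top_cond n) i * (b - g i)\<^sup>2) +
     (\<Sum>i\<le>2 ^ Suc n. \<Sum>j\<le>2 ^ Suc n.
       shift (2 ^ n) (\<lambda>i. shift (2 ^ n) (row_cond n i) j) i * (g i - g j)\<^sup>2) / 2"
proof -
  let ?N = "2 ^ n :: nat"
  have "(\<Sum>i\<le>2 * ?N. \<Sum>j\<le>2 * ?N. shift ?N (\<lambda>i. shift ?N (row_cond n i) j) i * (g i - g j)\<^sup>2) =
      (\<Sum>i\<le>2 * ?N. shift ?N (\<lambda>i. \<Sum>j\<le>2 * ?N. shift ?N (row_cond n i) j * (g (i + ?N) - g j)\<^sup>2) i * 1)"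
    by (rule sum.cong) (auto simp: shift_def)
  also have "\<dots> = (\<Sum>i\<le>?N. (\<Sum>j\<le>?N. row_cond n i j * (g (i + ?N) - g (j + ?N))\<^sup>2) * 1)"
    unfolding sum_shift ..
  finally show ?thesis by (simp add: trace_form_def sum_shift)
qed

lemma sum_top_cond: "(\<Sum>i\<le>2 ^ Suc n. top_cond n i) = top_sum n"
  "(\<Sum>i\<le>2 ^ Suc n. shift (2 ^ n) (top_cond n) i) = top_sum n"
  using sum_extend[of "2 ^ n" "top_cond n" "\<lambda>_. 1"] sum_shift[of "2 ^ n" "top_cond n" "\<lambda>_. 1"]
  by (simp_all add: top_sum_def top_cond_outside)

text \<open>\<open>A\<close> and \<open>B\<close> do not depend on \<open>a\<close> and
  \<open>b\<close>, so the identity yields both a lower bound in all \<open>a\<close>,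
  \<open>b\<close> and equality at \<open>a = A\<close>, \<open>b = B\<close>. Couplings inside the
  row are untouched by the elimination.\<close>

lemma trace_form_Suc:
  fixes t g n
  obtains A B where "\<And>a b. 5/3 * (tri t a b + trace_form n a g + trace_form n b (\<lambda>i. g (i + 2 ^ n))) =
    trace_form (Suc n) t g + 5/3 * ((a - A - (b - B))\<^sup>2 + (1 + top_sum n) * ((a - A)\<^sup>2 + (b - B)\<^sup>2))"
proof -
  let ?I = "{..2 ^ Suc n} :: nat set" and ?L = "top_cond n" and ?R = "shift (2 ^ n) (top_cond n)" and ?T = "top_sum n"
  define A where "A = ((2 + ?T) * (t + (\<Sum>i\<in>?I. ?L i * g i)) + (t + (\<Sum>i\<in>?I. ?R i * g i))) / ((1 + ?T) * (3 + ?T))"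
  define B where "B = ((2 + ?T) * (t + (\<Sum>i\<in>?I. ?R i * g i)) + (t + (\<Sum>i\<in>?I. ?L i * g i))) / ((1 + ?T) * (3 + ?T))"
  let ?K = "\<lambda>i j. ((2 + ?T) * (?L i * ?L j + ?R i * ?R j) + (?L i * ?R j + ?R i * ?L j)) / ((1 + ?T) * (3 + ?T))"
  have *: "tri t a b + (\<Sum>i\<in>?I. ?L i * (a - g i)\<^sup>2) + (\<Sum>i\<in>?I. ?R i * (b - g i)\<^sup>2) =
    (\<Sum>i\<in>?I. (?L i + ?R i) / (1 + ?T) * (t - g i)\<^sup>2) + (\<Sum>i\<in>?I. \<Sum>j\<in>?I. ?K i j * (g i - g j)\<^sup>2) / 2 +
    ((a - A - (b - B))\<^sup>2 + (1 + ?T) * ((a - A)\<^sup>2 + (b - B)\<^sup>2))" for a b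
    unfolding A_def B_def by (rule eliminate_two_nodes[OF sum_top_cond top_sum_nonneg])
  let ?row = "\<lambda>c. \<Sum>i\<in>?I. \<Sum>j\<in>?I. c i j * (g i - g j)\<^sup>2"
  have "trace_form (Suc n) t g = 5/3 * ((\<Sum>i\<in>?I. (?L i + ?R i) / (1 + ?T) * (t - g i)\<^sup>2) +
     ?row (row_cond n) / 2 + ?row (\<lambda>i j. shift (2 ^ n) (\<lambda>i. shift (2 ^ n) (row_cond n i) j) i) / 2 + ?row ?K / 2)"
  proof -
    have "(\<Sum>i\<in>?I. top_cond (Suc n) i * (t - g i)\<^sup>2) = 5/3 * (\<Sum>i\<in>?I. (?L i + ?R i) / (1 + ?T) * (t - g i)\<^sup>2)"
      unfolding top_cond_Suc sum_distrib_left by (intro sum.cong refl) (simp only: mult.assoc)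
    moreover have "?row (row_cond (Suc n)) = 5/3 * (?row (row_cond n) +
        ?row (\<lambda>i j. shift (2 ^ n) (\<lambda>i. shift (2 ^ n) (row_cond n i) j) i) + ?row ?K)"
      unfolding row_cond.simps(2) sum_distrib_left sum.distrib[symmetric]
      by (intro sum.cong refl) (simp only: distrib_left distrib_right mult.assoc)
    ultimately show ?thesis unfolding trace_form_def by simp
  qed
  note Suc_eq = this
  have key: "5/3 * (w + (p + r / 2) + (s + r' / 2)) = 5/3 * (u + r / 2 + r' / 2 + k / 2) + 5/3 * e"
    if "w + p + s = u + k / 2 + e" for w p s u k e r r' :: real
    using that by (simp add: field_simps)
  have "5/3 * (tri t a b + trace_form n a g + trace_form n b (\<lambda>i. g (i + 2 ^ n))) =
    trace_form (Suc n) t g + 5/3 * ((a - A - (b - B))\<^sup>2 + (1 + ?T) * ((a - A)\<^sup>2 + (b - B)\<^sup>2))" for a b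
    unfolding Suc_eq trace_form_left[of n a g] trace_form_right[of n b g] by (rule key[OF *])
  then show thesis by (rule that)
qed

lemma trace_form_0: "trace_form 0 t g = tri t (g 0) (g 1)"
  by (simp add: trace_form_def tri_def power2_commute)

section \<open>Mirror symmetry and closed forms of the coefficients\<close>

lemma shift_reflect:
  assumes "\<And>i. i \<le> N \<Longrightarrow> f (N - i) = f i" "\<And>i. N < i \<Longrightarrow> f i = 0" "i \<le> 2 * N"
  shows "f (2 * N - i) = shift N f i" "shift N f (2 * N - i) = f i"
proof -
  show "f (2 * N - i) = shift N f i"
  proof (cases "N \<le> i")
    case True
    then have "f (2 * N - i) = f (N - (i - N))" by (intro arg_cong[of _ _ f]) auto
    also have "\<dots> = f (i - N)" using assms(3) by (intro assms(1)) auto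
    finally show ?thesis using True by (simp add: shift_def)
  next
    case False
    then show ?thesis using assms by (simp add: shift_def)
  qed
  show "shift N f (2 * N - i) = f i"
  proof (cases "i \<le> N")
    case True
    then have "2 * N - i - N = N - i" "N \<le> 2 * N - i" by auto
    then show ?thesis using True assms by (simp add: shift_def)
  next
    case False
    then show ?thesis using assms by (simp add: shift_def)
  qed
qed

lemma top_cond_reflect: "i \<le> 2 ^ n \<Longrightarrow> top_cond n (2 ^ n - i) = top_cond n i"
proof (induction n arbitrary: i)
  case (Suc n)
  then have "top_cond n (2 * 2 ^ n - i) = shift (2 ^ n) (top_cond n) i"
    "shift (2 ^ n) (top_cond n) (2 * 2 ^ n - i) = top_cond n i"
    by (auto intro!: shift_reflect top_cond_outside)
  then show ?case unfolding top_cond_Suc by simp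
qed simp

text \<open>The reflection exchanges the two halves, and the term from the elimination is symmetric
  under exchanging \<open>L\<close> and \<open>R\<close>. It identifies the right end of the left
  half with the left end, where the closed forms are known.\<close>

lemma row_cond_reflect:
  "i \<le> 2 ^ n \<Longrightarrow> j \<le> 2 ^ n \<Longrightarrow> row_cond n (2 ^ n - i) (2 ^ n - j) = row_cond n i j"
proof (induction n arbitrary: i j)
  case (Suc n)
  let ?N = "2 ^ n :: nat"
  have top: "top_cond n (2 * ?N - i) = shift ?N (top_cond n) i"
    "shift ?N (top_cond n) (2 * ?N - i) = top_cond n i" if "i \<le> 2 * ?N" for i
    using that by (auto intro!: shift_reflect top_cond_outside top_cond_reflect)
  have "row_cond n (2 * ?N - i) (2 * ?N - j) = shift ?N (\<lambda>i. shift ?N (row_cond n i) j) i"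
    "shift ?N (\<lambda>i. shift ?N (row_cond n i) (2 * ?N - j)) (2 * ?N - i) = row_cond n i j"
  proof -
    show "row_cond n (2 * ?N - i) (2 * ?N - j) = shift ?N (\<lambda>i. shift ?N (row_cond n i) j) i"
    proof (cases "?N \<le> i \<and> ?N \<le> j")
      case True
      then have "2 * ?N - i = ?N - (i - ?N)" "2 * ?N - j = ?N - (j - ?N)" by auto
      then show ?thesis using True Suc.prems Suc.IH[of "i - ?N" "j - ?N"] by (simp add: shift_def)
    next
      case False
      then have "2 ^ n < 2 * ?N - i \<or> 2 ^ n < 2 * ?N - j" by auto
      then show ?thesis using False by (auto simp: shift_def row_cond_outside)
    qed
    show "shift ?N (\<lambda>i. shift ?N (row_cond n i) (2 * ?N - j)) (2 * ?N - i) = row_cond n i j"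
    proof (cases "i \<le> ?N \<and> j \<le> ?N")
      case True
      then have "2 * ?N - i - ?N = ?N - i" "2 * ?N - j - ?N = ?N - j" "?N \<le> 2 * ?N - i" "?N \<le> 2 * ?N - j"
        by auto
      then show ?thesis using True Suc.IH by (simp add: shift_def)
    next
      case False
      then show ?thesis using Suc.prems by (auto simp: shift_def row_cond_outside)
    qed
  qed
  with Suc.prems top show ?case by (simp add: algebra_simps)
qed simp

text \<open>The reciprocal satisfies \<open>1 / T' = 3/10 * (1 / T + 1)\<close> with fixed point 3/7
  and initial value 1/2, so \<open>1 / T = 3/7 + (3/10) ^ n / 14\<close>.\<close>

lemma top_sum_closed: "top_sum n = 14 * 10 ^ n / (6 * 10 ^ n + 3 ^ n)"
proof (induction n)
  case 0
  have "{..Suc 0} = {0, Suc 0}" by auto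
  then show ?case by (simp add: top_sum_def)
next
  case (Suc n)
  have Suc_eq: "top_sum (Suc n) = 5/3 * ((top_sum n + top_sum n) / (1 + top_sum n))"
    unfolding top_sum_def[of "Suc n"] top_cond_Suc sum_distrib_left[symmetric] sum_divide_distrib[symmetric]
      sum.distrib sum_top_cond ..
  have pos: "6 * 10 ^ n + 3 ^ n > (0::real)" "20 * 10 ^ n + 3 ^ n > (0::real)"
    by (auto intro!: add_pos_pos)
  then have "1 + top_sum n = (20 * 10 ^ n + 3 ^ n) / (6 * 10 ^ n + 3 ^ n)"
    unfolding Suc by (simp add: field_simps)
  then have 1: "(top_sum n + top_sum n) / (1 + top_sum n) = 28 * 10 ^ n / (20 * 10 ^ n + 3 ^ n)"
    unfolding Suc using pos by (simp add: add_divide_distrib[symmetric])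
  show ?case unfolding Suc_eq 1 using pos by (simp add: field_simps)
qed

lemma one_plus_top_sum: "1 + top_sum n = (20 * 10 ^ n + 3 ^ n) / (6 * 10 ^ n + 3 ^ n)"
proof -
  have "6 * 10 ^ n + 3 ^ n > (0::real)" by (auto intro!: add_pos_pos)
  then show ?thesis unfolding top_sum_closed by (simp add: field_simps)
qed

text \<open>The leftmost point lies in the left copy only, so each level multiplies by
  \<open>5/3 / (1 + T)\<close>. The numerator of \<open>1 + T\<close> is a third of the next level's
  denominator, so the product telescopes.\<close>

lemma top_cond_first: "top_cond n 0 = 7 * 5 ^ n / (6 * 10 ^ n + 3 ^ n)"
proof (induction n)
  case (Suc n)
  have "6 * 10 ^ n + 3 ^ n > (0::real)" "20 * 10 ^ n + 3 ^ n > (0::real)"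
    by (auto intro!: add_pos_pos)
  then show ?case unfolding top_cond_Suc one_plus_top_sum using Suc
    by (simp add: shift_def field_simps)
qed simp

text \<open>At level 1 the point with index 1 is the junction and collects a contribution from both
  copies. At higher levels indices 0 and 1 lie in the left copy only and get the same factor, so the
  ratio 2 persists; at level 0 it is 1.\<close>

lemma top_cond_second: "top_cond (Suc n) 1 = 2 * top_cond (Suc n) 0"
proof (induction n)
  case 0
  then show ?case by (simp add: top_cond_Suc shift_def)
next
  case (Suc n)
  have "\<not> 2 ^ Suc n \<le> (1::nat)" "\<not> 2 ^ Suc n \<le> (0::nat)"
    using one_less_power[of "2::nat" "Suc n"] by linarith+
  then show ?case using Suc unfolding top_cond_Suc[of "Suc n"] shift_def by (simp del: top_cond.simps)
qed

text \<open>The junction belongs to both copies and its left neighbour to the left one only. Hence a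
  product of the \<open>2 + T\<close> part and a mixed product survive, and together they cancel the
  factor \<open>3 + T\<close>.\<close>

lemma row_cond_middle:
  "row_cond (Suc n) (2 ^ n - 1) (2 ^ n) =
     5/3 * (row_cond n 0 1 + top_cond n 0 * top_cond n 1 / (1 + top_sum n))"
proof -
  let ?N = "2 ^ n :: nat" and ?T = "top_sum n"
  have N: "\<not> ?N \<le> ?N - 1" "1 \<le> ?N" by (simp_all add: not_le)
  have r: "top_cond n (?N - 1) = top_cond n 1" "top_cond n ?N = top_cond n 0"
    "row_cond n (?N - 1) ?N = row_cond n 0 1"
    using top_cond_reflect[OF N(2)] top_cond_reflect[of 0 n] row_cond_reflect[OF N(2), of 0]
    by (simp_all add: row_cond_commute[of n "Suc 0"])
  have T: "1 + ?T > 0" "3 + ?T > 0" using top_sum_nonneg[of n] by simp_all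
  have "row_cond (Suc n) (?N - 1) ?N = 5/3 * (row_cond n 0 1 +
      ((2 + ?T) * (top_cond n 1 * top_cond n 0) + top_cond n 1 * top_cond n 0) / ((1 + ?T) * (3 + ?T)))"
    unfolding row_cond.simps(2) shift_def r using N(1) by simp
  also have "(2 + ?T) * (top_cond n 1 * top_cond n 0) + top_cond n 1 * top_cond n 0 =
      top_cond n 0 * top_cond n 1 * (3 + ?T)"
    by (simp add: algebra_simps)
  finally show ?thesis using T by simp
qed

lemma row_cond_middle_reflect:
  "row_cond (Suc n) (2 ^ n) (2 ^ n + 1) = row_cond (Suc n) (2 ^ n - 1) (2 ^ n)"
proof -
  have 1: "1 \<le> (2 ^ n :: nat)" by simp
  then have "2 ^ Suc n - (2 ^ n + 1) = (2 ^ n - 1 :: nat)" "2 ^ Suc n - 2 ^ n = (2 ^ n :: nat)" by simp_all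
  moreover have "row_cond (Suc n) (2 ^ Suc n - 2 ^ n) (2 ^ Suc n - (2 ^ n + 1)) =
      row_cond (Suc n) (2 ^ n) (2 ^ n + 1)"
    using 1 by (intro row_cond_reflect) simp_all
  ultimately show ?thesis by (metis row_cond_commute)
qed

text \<open>By polarisation: \<open>d\<close> is tested on the sum and the difference of two indicator functions.\<close>

lemma quadratic_form_zero:
  fixes d :: "'a \<Rightarrow> 'a \<Rightarrow> real"
  assumes "finite A" "\<And>x y. d x y = d y x" "x \<in> A" "y \<in> A" "x \<noteq> y"
    and zero: "\<And>f. (\<Sum>x\<in>A. \<Sum>y\<in>A. d x y * (f x - f y)\<^sup>2) = 0"
  shows "d x y = 0"
proof -
  define f g :: "'a \<Rightarrow> real" where "f v = (if v = x then 1 else 0)" and "g v = (if v = y then 1 else 0)" for v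
  have "(\<Sum>v\<in>A. \<Sum>w\<in>A. 4 * (d v w * ((f v - f w) * (g v - g w)))) =
     (\<Sum>v\<in>A. \<Sum>w\<in>A. d v w * ((f v + g v) - (f w + g w))\<^sup>2) -
     (\<Sum>v\<in>A. \<Sum>w\<in>A. d v w * ((f v - g v) - (f w - g w))\<^sup>2)"
    unfolding sum_subtractf[symmetric] by (intro sum.cong refl) (simp add: power2_eq_square algebra_simps)
  also have "\<dots> = 0" unfolding zero[of "\<lambda>v. f v + g v"] zero[of "\<lambda>v. f v - g v"] by simp
  finally have 0: "(\<Sum>v\<in>A. \<Sum>w\<in>A. 4 * (d v w * ((f v - f w) * (g v - g w)))) = 0" .
  have "4 * (d v w * ((f v - f w) * (g v - g w))) =
     (if w = y then if v = x then - 4 * d x y else 0 else 0) +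
     (if w = x then if v = y then - 4 * d x y else 0 else 0)" for v w
    using assms(2,5) unfolding f_def g_def by auto
  with 0 show ?thesis using assms(1,3,4) by (simp add: sum.distrib)
qed

text \<open>Two minimisers for the same prescribed values have equal energy, so the difference of
  the coefficients is a form vanishing for every \<open>f\<close>.\<close>

lemma is_conductance_unique:
  assumes A: "finite A" and c: "is_conductance q A c" and c': "is_conductance q A c'"
  shows "c = c'"
proof (intro ext)
  fix x y
  have out: "c x y = 0" "c' x y = 0" if "x \<notin> A \<or> y \<notin> A \<or> x = y" for x y
    using that c c' unfolding is_conductance_def by blast+
  have form: "\<exists>u. least_energy_extension q A f u \<and> energy q u = ereal ((\<Sum>x\<in>A. \<Sum>y\<in>A. c x y * (f x - f y)\<^sup>2) / 2)"
    if c: "is_conductance q A c" for c f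
  proof -
    obtain u where u: "least_energy_extension q A f u"
      "energy q u = ereal ((\<Sum>x\<in>A. \<Sum>y\<in>A. c x y * (u x - u y)\<^sup>2) / 2)"
      using c unfolding is_conductance_def by blast
    moreover have "(\<Sum>x\<in>A. \<Sum>y\<in>A. c x y * (u x - u y)\<^sup>2) = (\<Sum>x\<in>A. \<Sum>y\<in>A. c x y * (f x - f y)\<^sup>2)"
      using u(1) unfolding least_energy_extension_def by (intro sum.cong refl) auto
    ultimately show ?thesis by auto
  qed
  have "(\<Sum>x\<in>A. \<Sum>y\<in>A. (c x y - c' x y) * (f x - f y)\<^sup>2) = 0" for f
  proof -
    obtain u where "least_energy_extension q A f u"
      "energy q u = ereal ((\<Sum>x\<in>A. \<Sum>y\<in>A. c x y * (f x - f y)\<^sup>2) / 2)"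
      using form[OF c] by blast
    moreover obtain u' where "least_energy_extension q A f u'"
      "energy q u' = ereal ((\<Sum>x\<in>A. \<Sum>y\<in>A. c' x y * (f x - f y)\<^sup>2) / 2)"
      using form[OF c'] by blast
    moreover from calculation have "energy q u = energy q u'"
      unfolding least_energy_extension_def by (intro antisym) auto
    ultimately show ?thesis by (simp add: left_diff_distrib sum_subtractf)
  qed
  then have "c x y - c' x y = 0" if "x \<in> A" "y \<in> A" "x \<noteq> y"
    using that A c c' unfolding is_conductance_def
    by (intro quadratic_form_zero[of A "\<lambda>x y. c x y - c' x y"]) auto
  then show "c x y = c' x y" using out by force
qed

section \<open>Identification of the conductances\<close>

lemma bottom_point_Suc_left: "bottom_point q (Suc n) i = F q 1 (bottom_point q n i)"
  by (simp add: bottom_point_def F_def vec_eq_iff field_simps)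

lemma bottom_point_Suc_right: "bottom_point q (Suc n) (i + 2 ^ n) = F q 2 (bottom_point q n i)"
  by (simp add: bottom_point_def F_def vec_eq_iff field_simps)

lemma bottom_point_ends: "bottom_point q n 0 = q 1" "bottom_point q n (2 ^ n) = q 2"
  by (simp_all add: bottom_point_def)

context gasket
begin

text \<open>The top cell is bounded below by its level 0 energy, the other two by induction; the
  square left over from the elimination is dropped.\<close>

lemma trace_form_le_energy:
  "n \<le> m \<Longrightarrow> trace_form n (u (q 0)) (\<lambda>i. u (bottom_point q n i)) \<le> renormalized_energy m u"
proof (induction n arbitrary: m u)
  case 0
  have "trace_form 0 (u (q 0)) (\<lambda>i. u (bottom_point q 0 i)) = renormalized_energy 0 u"
    using bottom_point_ends[of q 0] by (simp add: trace_form_0 renormalized_energy_0)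
  then show ?case using renormalized_energy_mono[of 0 m u] by simp
next
  case (Suc n)
  then obtain k where k: "m = Suc k" "n \<le> k" by (cases m) auto
  let ?a = "u (F q 0 (q 1))" and ?b = "u (F q 0 (q 2))" and ?g = "\<lambda>i. u (bottom_point q (Suc n) i)"
  obtain A B where AB: "\<And>a b. 5/3 * (tri (u (q 0)) a b + trace_form n a ?g +
      trace_form n b (\<lambda>i. ?g (i + 2 ^ n))) = trace_form (Suc n) (u (q 0)) ?g +
      5/3 * ((a - A - (b - B))\<^sup>2 + (1 + top_sum n) * ((a - A)\<^sup>2 + (b - B)\<^sup>2))"
    using trace_form_Suc[of "u (q 0)" n ?g] by blast
  have "trace_form (Suc n) (u (q 0)) ?g \<le>
      5/3 * (tri (u (q 0)) ?a ?b + trace_form n ?a ?g + trace_form n ?b (\<lambda>i. ?g (i + 2 ^ n)))"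
    unfolding AB using top_sum_nonneg[of n] by simp
  also have "\<dots> \<le> 5/3 * (renormalized_energy k (u \<circ> F q 0) +
      renormalized_energy k (u \<circ> F q 1) + renormalized_energy k (u \<circ> F q 2))"
  proof (intro mult_left_mono add_mono)
    show "tri (u (q 0)) ?a ?b \<le> renormalized_energy k (u \<circ> F q 0)"
      using renormalized_energy_mono[of 0 k "u \<circ> F q 0"] by (simp add: renormalized_energy_0)
    show "trace_form n ?a ?g \<le> renormalized_energy k (u \<circ> F q 1)"
      using Suc.IH[OF k(2), of "u \<circ> F q 1"] by (simp only: bottom_point_Suc_left F_commute[of q 0] comp_def)
    show "trace_form n ?b (\<lambda>i. ?g (i + 2 ^ n)) \<le> renormalized_energy k (u \<circ> F q 2)"
      using Suc.IH[OF k(2), of "u \<circ> F q 2"] by (simp only: bottom_point_Suc_right F_commute[of q 0] comp_def)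
  qed simp
  finally show ?case unfolding k renormalized_energy_Suc .
qed

lemma trace_form_attained:
  obtains u where "continuous_on (SG q) u" "u (q 0) = t"
    "\<And>i. i \<le> 2 ^ n \<Longrightarrow> u (bottom_point q n i) = g i"
    "\<And>m. n \<le> m \<Longrightarrow> renormalized_energy m u = trace_form n t g"
proof -
  have "\<exists>u. continuous_on (SG q) u \<and> u (q 0) = t \<and> (\<forall>i\<le>2 ^ n. u (bottom_point q n i) = g i) \<and>
    (\<forall>m\<ge>n. renormalized_energy m u = trace_form n t g)"
  proof (induction n arbitrary: t g)
    case 0
    obtain h where h: "continuous_on (SG q) h" "h (q 0) = t" "h (q 1) = g 0" "h (q 2) = g 1"
      "\<And>m. renormalized_energy m h = tri t (g 0) (g 1)"
      by (rule harmonic_extension[of t "g 0" "g 1"]) (rule that)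
    have "\<forall>i\<le>2 ^ 0. h (bottom_point q 0 i) = g i"
      using h(3,4) bottom_point_ends[of q 0] by (auto simp: le_Suc_eq)
    with h show ?case unfolding trace_form_0 by blast
  next
    case (Suc n)
    obtain A B where AB: "\<And>a b. 5/3 * (tri t a b + trace_form n a g +
        trace_form n b (\<lambda>i. g (i + 2 ^ n))) = trace_form (Suc n) t g +
        5/3 * ((a - A - (b - B))\<^sup>2 + (1 + top_sum n) * ((a - A)\<^sup>2 + (b - B)\<^sup>2))"
      using trace_form_Suc[of t n g] by blast
    \<comment> \<open>The minimising values \<open>A\<close> and \<open>B\<close> at the inner
      vertices make the remainder of the elimination zero.\<close>
    obtain h where h: "continuous_on (SG q) h" "h (q 0) = t" "h (q 1) = A" "h (q 2) = B"
      "\<And>m. renormalized_energy m h = tri t A B"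
      by (rule harmonic_extension[of t A B]) (rule that)
    obtain v where v: "continuous_on (SG q) v" "v (q 0) = A" "\<And>i. i \<le> 2 ^ n \<Longrightarrow> v (bottom_point q n i) = g i"
      "\<And>m. n \<le> m \<Longrightarrow> renormalized_energy m v = trace_form n A g"
      using Suc.IH by blast
    obtain w where w: "continuous_on (SG q) w" "w (q 0) = B"
      "\<And>i. i \<le> 2 ^ n \<Longrightarrow> w (bottom_point q n i) = g (i + 2 ^ n)"
      "\<And>m. n \<le> m \<Longrightarrow> renormalized_energy m w = trace_form n B (\<lambda>i. g (i + 2 ^ n))"
      using Suc.IH[of B "\<lambda>i. g (i + 2 ^ n)"] by blast
    \<comment> \<open>The bottom junction is the last point of the left half and the first of the
      right half; both pieces take the value \<open>g (2 ^ n)\<close> there.\<close>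
    have compat: "h (q 1) = v (q 0)" "h (q 2) = w (q 0)" "v (q 2) = w (q 1)"
      using h v(2) w(2) v(3)[of "2 ^ n"] w(3)[of 0] by (simp_all add: bottom_point_ends)
    have bottom_SG: "bottom_point q n i \<in> SG q" if "i \<le> 2 ^ n" for i
      using that
    proof (induction n arbitrary: i)
      case 0
      then show ?case using bottom_point_ends[of q 0] vertex_SG by (auto simp: le_Suc_eq)
    next
      case (Suc n)
      show ?case
      proof (cases "i \<le> 2 ^ n")
        case True
        then show ?thesis unfolding bottom_point_Suc_left by (intro F_SG Suc.IH) auto
      next
        case False
        then have "bottom_point q (Suc n) i = F q 2 (bottom_point q n (i - 2 ^ n))"
          using bottom_point_Suc_right[of q n "i - 2 ^ n"] by simp
        then show ?thesis using False Suc.prems by (simp add: F_SG Suc.IH)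
      qed
    qed
    let ?u = "glue3 h v w"
    have "?u (bottom_point q (Suc n) i) = g i" if i: "i \<le> 2 ^ Suc n" for i
    proof (cases "i \<le> 2 ^ n")
      case True
      then show ?thesis
        unfolding bottom_point_Suc_left glue3_F(2)[OF compat bottom_SG[OF True]] by (rule v(3))
    next
      case False
      then have j: "i - 2 ^ n \<le> 2 ^ n" and eq: "i - 2 ^ n + 2 ^ n = i" using i by auto
      show ?thesis
        using bottom_point_Suc_right[of q n "i - 2 ^ n"] glue3_F(3)[OF compat bottom_SG[OF j]] w(3)[OF j]
        unfolding eq by simp
    qed
    moreover have "renormalized_energy m ?u = trace_form (Suc n) t g" if m: "Suc n \<le> m" for m
    proof -
      obtain k where k: "m = Suc k" "n \<le> k" using m by (cases m) auto
      show ?thesis unfolding k(1) renormalized_energy_glue3[OF compat] h(5) v(4)[OF k(2)] w(4)[OF k(2)] AB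
        by simp
    qed
    moreover have "continuous_on (SG q) ?u" using compat h(1) v(1) w(1) by (rule continuous_on_glue3)
    moreover have "?u (q 0) = t" using glue3_vertex(1)[OF compat] h(2) by simp
    ultimately show ?case by blast
  qed
  then show thesis using that by blast
qed

lemma bottom_point_inj: "inj_on (bottom_point q n) {..2 ^ n}"
  using vertices_distinct(3) by (auto simp: inj_on_def bottom_point_def)

text \<open>Coordinate 0 is affine and vanishes at \<open>q 1\<close> and \<open>q 2\<close>, hence
  along the whole bottom line, whereas it is 1 at \<open>q 0\<close>.\<close>

lemma top_not_bottom: "q 0 \<noteq> bottom_point q n i"
proof
  assume eq: "q 0 = bottom_point q n i"
  define r where "r = real i / 2 ^ n"
  have "1 + k * (a + r * (b - a) - c) = 1 + k * (a - c) + r * ((1 + k * (b - c)) - (1 + k * (a - c)))"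
    for a b c k :: real
    by (simp add: algebra_simps)
  then have "bary 0 (bottom_point q n i) = bary 0 (q 1) + r * (bary 0 (q 2) - bary 0 (q 1))"
    unfolding bottom_point_def r_def[symmetric] bary_def inner_diff_left inner_add_left inner_scaleR_left
    by blast
  then have "bary 0 (bottom_point q n i) = 0"
    using bary_vertex[of 0 1] bary_vertex[of 0 2] by simp
  then show False unfolding eq[symmetric] using bary_vertex[of 0 0] by simp
qed

lemma conductance_bottom_and_top:
  assumes ij: "i \<le> 2 ^ n" "j \<le> 2 ^ n" "i \<noteq> j"
  shows "row_conductance q n i j = row_cond n i j"
proof -
  let ?A = "bottom_and_top q n" and ?p = "bottom_point q n" and ?I = "{..2 ^ n} :: nat set"
  define ix where "ix = inv_into ?I ?p"
  have ix: "ix (?p i) = i" if "i \<le> 2 ^ n" for i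
    unfolding ix_def using that bottom_point_inj by (simp add: inv_into_f_f)
  \<comment> \<open>The diagonal is set to 0 as \<open>is_conductance\<close> demands;
    \<open>row_cond n i i\<close> need not vanish.\<close>
  define c where "c x y = (if x \<notin> ?A \<or> y \<notin> ?A \<or> x = y then 0 else if x = q 0 then top_cond n (ix y)
    else if y = q 0 then top_cond n (ix x) else row_cond n (ix x) (ix y))" for x y
  have A: "?A = insert (q 0) (?p ` ?I)" by (simp add: bottom_and_top_def atLeast0AtMost)
  have pA: "?p i \<in> ?A" if "i \<le> 2 ^ n" for i using that A by auto
  have fin: "finite ?A" by (simp add: A)
  have sumA: "(\<Sum>x\<in>?A. f x) = f (q 0) + (\<Sum>i\<le>2 ^ n. f (?p i))" for f :: "real^2 \<Rightarrow> real"
    unfolding A using top_not_bottom bottom_point_inj by (subst sum.insert) (auto simp: sum.reindex)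
  have form: "(\<Sum>x\<in>?A. \<Sum>y\<in>?A. c x y * (u x - u y)\<^sup>2) / 2 = trace_form n (u (q 0)) (\<lambda>i. u (?p i))" for u
  proof -
    have t: "c (q 0) (?p i) * (u (q 0) - u (?p i))\<^sup>2 = top_cond n i * (u (q 0) - u (?p i))\<^sup>2"
      "c (?p i) (q 0) * (u (?p i) - u (q 0))\<^sup>2 = top_cond n i * (u (q 0) - u (?p i))\<^sup>2"
      if "i \<in> ?I" for i
      using that top_not_bottom[of n i] pA[of i] ix[of i] A by (auto simp: c_def power2_commute)
    have r: "c (?p i) (?p j) * (u (?p i) - u (?p j))\<^sup>2 = row_cond n i j * (u (?p i) - u (?p j))\<^sup>2"
      if "i \<in> ?I" "j \<in> ?I" for i j
      using that top_not_bottom[of n i] top_not_bottom[of n j] pA[of i] pA[of j] ix[of i] ix[of j]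
      by (auto simp: c_def)
    have "(\<Sum>i\<le>2 ^ n. c (q 0) (?p i) * (u (q 0) - u (?p i))\<^sup>2) = (\<Sum>i\<le>2 ^ n. top_cond n i * (u (q 0) - u (?p i))\<^sup>2)"
      "(\<Sum>i\<le>2 ^ n. c (?p i) (q 0) * (u (?p i) - u (q 0))\<^sup>2) = (\<Sum>i\<le>2 ^ n. top_cond n i * (u (q 0) - u (?p i))\<^sup>2)"
      "(\<Sum>i\<le>2 ^ n. \<Sum>j\<le>2 ^ n. c (?p i) (?p j) * (u (?p i) - u (?p j))\<^sup>2) =
        (\<Sum>i\<le>2 ^ n. \<Sum>j\<le>2 ^ n. row_cond n i j * (u (?p i) - u (?p j))\<^sup>2)"
      by (intro sum.cong refl t r; assumption)+
    then show ?thesis unfolding sumA sum.distrib trace_form_def by simp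
  qed
  have cond: "is_conductance q ?A c"
    unfolding is_conductance_def
  proof (intro conjI allI impI)
    fix x y
    show "c x y = c y x"
      using row_cond_commute[of n "ix x" "ix y"]
      by (cases "x = q 0"; cases "y = q 0") (auto simp: c_def)
    show "x \<notin> ?A \<or> y \<notin> ?A \<or> x = y \<Longrightarrow> c x y = 0" by (auto simp: c_def)
  next
    fix f
    obtain u where u: "continuous_on (SG q) u" "u (q 0) = f (q 0)"
      "\<And>i. i \<le> 2 ^ n \<Longrightarrow> u (?p i) = f (?p i)"
      "\<And>m. n \<le> m \<Longrightarrow> renormalized_energy m u = trace_form n (f (q 0)) (\<lambda>i. f (?p i))"
      using trace_form_attained[where t = "f (q 0)" and g = "\<lambda>i. f (?p i)" and n = n] by blast
    have e: "energy q u = ereal (trace_form n (f (q 0)) (\<lambda>i. f (?p i)))"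
      by (rule energy_eventually_const) (rule u(4))
    \<comment> \<open>The bound at level \<open>n\<close> already suffices, since the energy is the
      supremum over all levels.\<close>
    have min: "energy q u \<le> energy q v" if "\<forall>x\<in>?A. v x = f x" for v
    proof -
      have "trace_form n (f (q 0)) (\<lambda>i. f (?p i)) = trace_form n (v (q 0)) (\<lambda>i. v (?p i))"
        using that A by (auto intro!: trace_form_cong)
      also have "\<dots> \<le> renormalized_energy n v" by (rule trace_form_le_energy) simp
      finally show ?thesis
        unfolding e using renormalized_energy_le_energy[of n v] by (meson ereal_less_eq(3) order_trans)
    qed
    have "least_energy_extension q ?A f u"
      unfolding least_energy_extension_def dom_energy_def using u(1-3) e min A by auto
    moreover have "energy q u = ereal ((\<Sum>x\<in>?A. \<Sum>y\<in>?A. c x y * (u x - u y)\<^sup>2) / 2)"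
      unfolding form e u(2) using u(3) by (auto intro!: trace_form_cong)
    ultimately show "\<exists>u. least_energy_extension q ?A f u \<and>
        energy q u = ereal ((\<Sum>x\<in>?A. \<Sum>y\<in>?A. c x y * (u x - u y)\<^sup>2) / 2)" by blast
  qed
  have "conductance q ?A = c"
    unfolding conductance_def
    by (rule the_equality[where P = "is_conductance q ?A", OF cond])
      (rule is_conductance_unique[OF fin _ cond])
  moreover have "?p i \<noteq> ?p j" using ij bottom_point_inj by (auto simp: inj_on_def)
  ultimately show ?thesis
    unfolding row_conductance_def using ij pA ix top_not_bottom[of n i] top_not_bottom[of n j]
    by (auto simp: c_def)
qed

end

theorem lemma2p20:
  fixes q :: "nat \<Rightarrow> real^2"
  assumes "equilateral q"
  shows "(\<forall>n\<ge>1. middle_conductance q n = row_conductance q n (2 ^ (n - 1)) (2 ^ (n - 1) + 1)) \<and>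
    middle_conductance q 1 = end_conductance q 1 \<and> end_conductance q 1 = 20 / 9 \<and>
    (\<forall>n\<ge>1. middle_conductance q (n + 1) =
       5 / 3 * end_conductance q n +
       294 * 25 ^ (n + 1) /
         ((3 ^ (n + 1) + 6 * 10 ^ (n + 1)) * (5 * 3 ^ (n + 1) + 9 * 10 ^ (n + 1))))"
proof -
  interpret gasket q by unfold_locales (rule assms)
  have one_le: "1 \<le> (2 ^ n :: nat)" for n by simp
  have mid: "middle_conductance q (Suc n) = row_cond (Suc n) (2 ^ n - 1) (2 ^ n)" for n
  proof -
    have "2 ^ n - 1 \<noteq> (2 ^ n :: nat)" using one_le[of n] by arith
    then show ?thesis
      unfolding middle_conductance_def diff_Suc_1 by (intro conductance_bottom_and_top) simp_all
  qed
  have mid': "row_conductance q (Suc n) (2 ^ n) (2 ^ n + 1) = row_cond (Suc n) (2 ^ n) (2 ^ n + 1)" for n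
    using one_le[of n] by (intro conductance_bottom_and_top) simp_all
  have endc: "end_conductance q n = row_cond n 0 1" for n
    unfolding end_conductance_def by (intro conductance_bottom_and_top) simp_all
  have "middle_conductance q n = row_conductance q n (2 ^ (n - 1)) (2 ^ (n - 1) + 1)" if n: "1 \<le> n" for n
  proof -
    obtain k where k: "n = Suc k" using n by (cases n) auto
    show ?thesis unfolding k diff_Suc_1 mid mid' by (rule row_cond_middle_reflect[symmetric])
  qed
  moreover have "middle_conductance q 1 = end_conductance q 1"
    using mid[of 0] endc[of 1] by simp
  moreover have "end_conductance q 1 = 20 / 9"
  proof -
    have "end_conductance q 1 = row_cond (Suc 0) (2 ^ 0 - 1) (2 ^ 0)"
      using mid[of 0] calculation(2) by (simp del: row_cond.simps)
    then show ?thesis unfolding row_cond_middle using top_sum_closed[of 0] by simp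
  qed
  moreover have "middle_conductance q (n + 1) = 5 / 3 * end_conductance q n + 294 * 25 ^ (n + 1) /
      ((3 ^ (n + 1) + 6 * 10 ^ (n + 1)) * (5 * 3 ^ (n + 1) + 9 * 10 ^ (n + 1)))" if n: "1 \<le> n" for n
  proof -
    obtain k where k: "n = Suc k" using n by (cases n) auto
    \<comment> \<open>Denominator and numerator of \<open>1 + top_sum n\<close>; writing
      \<open>n\<close> as a successor makes the ratio 2 of the first two top coefficients
      available.\<close>
    define x y :: real where "x = 6 * 10 ^ n + 3 ^ n" and "y = 20 * 10 ^ n + 3 ^ n"
    have pos: "x > 0" "y > 0" unfolding x_def y_def by (auto intro!: add_pos_pos)
    have 25: "5 ^ n * 5 ^ n = (25 ^ n :: real)" by (simp flip: power_mult_distrib)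
    have "5/3 * (top_cond n 0 * top_cond n 1 / (1 + top_sum n)) = 490 / 3 * (5 ^ n * 5 ^ n) / (x * y)"
      using pos top_cond_second[of k] unfolding k[symmetric] top_cond_first one_plus_top_sum x_def[symmetric] y_def[symmetric]
      by (simp add: field_simps)
    \<comment> \<open>Expanding by 45 turns \<open>490 / 3\<close> into \<open>294 * 25\<close>;
      distributing it as 3 and 15 brings both factors to exponent \<open>n + 1\<close>.\<close>
    also have "\<dots> = 294 * 25 ^ (n + 1) / ((3 * y) * (15 * x))"
      using pos unfolding 25 by (simp add: field_simps)
    also have "(3 * y) * (15 * x) = (3 ^ (n + 1) + 6 * 10 ^ (n + 1)) * (5 * 3 ^ (n + 1) + 9 * 10 ^ (n + 1))"
      unfolding x_def y_def by (simp add: algebra_simps)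
    finally show ?thesis
      unfolding Suc_eq_plus1[symmetric] mid row_cond_middle endc distrib_left[of "5/3"] by (simp only:)
  qed
  ultimately show ?thesis by blast
qed

end
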